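(* Let $q\in\mathbb{R}$, $q\ne0$, and consider the stationary equation $$-u_{xx}+(1+q\delta_0(x))\sin u=0,\qquad x\in\mathbb{R}.\qquad( * )$$ (i) If $|q|\le 2$, there exist no nontrivial (i.e. not identically zero) solutions of $( * )$ in $H^1(\mathbb{R})$. (ii) If $|q|>2$, there exists a unique positive solution of $( * )$ in $H^1(\mathbb{R})$, given by $$Q(x)=4\arctan\left(\sqrt{\frac{q+2}{q-2}}\;e^{-|x|}\right).$$ (iii) For any $q\neq0$ the unique $u\in H^1_{\sin}(\mathbb{R})$ solving $( * )$ with $\lim_{x\to-\infty}u(x)=0$ and $\lim_{x\to\infty}u(x)=2\pi$ is the static kink $K(x)=4\arctan e^x$.
   Context: All functions are real valued; $\delta_0$ is the Dirac delta at $x=0$. $H^1_{\sin}(\mathbb{R})=\{u\in\dot H^1(\mathbb{R}):\sin(u/2)\in L^2(\mathbb{R})\}$ (elements are continuous; it contains $H^1(\mathbb{R})$). A function $u\in H^1_{\sin}(\mathbb{R})$ solves $( * )$ if for every $\varphi\in H^1(\mathbb{R})$, $$\int_{\mathbb{R}}u_x\varphi_x\,dx+\int_{\mathbb{R}}\sin(u)\,\varphi\,dx+q\sin(u(0))\varphi(0)=0.$$ *)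

theory Defs
  imports "HOL-Analysis.Analysis"
begin

definition test_function :: "(real \<Rightarrow> real) \<Rightarrow> bool" where
  "test_function \<phi> \<longleftrightarrow>
     (\<forall>n x. (deriv ^^ n) \<phi> field_differentiable (at x)) \<and> compact (closure {x. \<phi> x \<noteq> 0})"

definition locally_integrable :: "(real \<Rightarrow> real) \<Rightarrow> bool" where
  "locally_integrable f \<longleftrightarrow> (\<forall>a b. set_integrable lborel {a..b} f)"

definition has_weak_deriv :: "(real \<Rightarrow> real) \<Rightarrow> (real \<Rightarrow> real) \<Rightarrow> bool" where
  "has_weak_deriv u v \<longleftrightarrow> locally_integrable u \<and> locally_integrable v \<and>
     (\<forall>\<phi>. test_function \<phi> \<longrightarrow>
        (\<integral>x. u x * deriv \<phi> x \<partial>lborel) = - (\<integral>x. v x * \<phi> x \<partial>lborel))"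

(* A weak derivative is unique only up to null sets; weak_deriv selects a representative.
   It is only used under integrals, whose values do not depend on the choice. *)
definition weak_deriv :: "(real \<Rightarrow> real) \<Rightarrow> real \<Rightarrow> real" where
  "weak_deriv u = (SOME v. has_weak_deriv u v)"

definition L2 :: "(real \<Rightarrow> real) set" where
  "L2 = {f. f \<in> borel_measurable lborel \<and> integrable lborel (\<lambda>x. (f x)\<^sup>2)}"

(* Every class in the Sobolev spaces below has exactly one continuous representative.
   The spaces consist of these representatives, so that u 0 makes sense and equality of
   elements is equality of functions. *)
definition Hdot1 :: "(real \<Rightarrow> real) set" where
  "Hdot1 = {u. continuous_on UNIV u \<and> (\<exists>v\<in>L2. has_weak_deriv u v)}"

definition H1 :: "(real \<Rightarrow> real) set" where
  "H1 = L2 \<inter> Hdot1"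

definition H1sin :: "(real \<Rightarrow> real) set" where
  "H1sin = {u \<in> Hdot1. (\<lambda>x. sin (u x / 2)) \<in> L2}"

(* The weak form of - u_xx + (1 + q delta_0) sin u = 0 on the real line. *)
definition solves :: "real \<Rightarrow> (real \<Rightarrow> real) \<Rightarrow> bool" where
  "solves q u \<longleftrightarrow> u \<in> H1sin \<and>
     (\<forall>\<phi>\<in>H1. (\<integral>x. weak_deriv u x * weak_deriv \<phi> x \<partial>lborel)
            + (\<integral>x. sin (u x) * \<phi> x \<partial>lborel)
            + q * sin (u 0) * \<phi> 0 = 0)"

definition Q :: "real \<Rightarrow> real \<Rightarrow> real" where
  "Q q x = 4 * arctan (sqrt ((q + 2) / (q - 2)) * exp (- \<bar>x\<bar>))"

definition kink :: "real \<Rightarrow> real" where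
  "kink x = 4 * arctan (exp x)"

end

(* Testing the weak equation with piecewise linear hat functions shows that u differs by an affine
   function from a twice integrated sin u plus q sin(u 0) max x 0.  So on each half line u solves
   the pendulum equation y'' = sin y, and y' jumps by q sin(u 0) at 0.  Where y tends to 0 the
   energy y'^2 - 4 sin^2(y/2) vanishes, i.e. the product of y' + 2 sin(y/2) and y' - 2 sin(y/2) is 0.
   The first factor solves a linear first order equation, so it vanishes identically or nowhere;
   hence one of the two factors vanishes identically and y = 4 arctan(c e^(-x)).  The jump condition
   then determines c.  Conversely, these profiles decay exponentially, and integrating by parts
   against an arbitrary H^1 function, which tends to 0 at infinity, gives the weak equation. *)

theory Submission
  imports Defs
begin

text \<open>The Sobolev spaces are defined by smooth compactly supported test functions, and
  \<open>weak_deriv\<close> is an arbitrary choice, whereas hat functions and the profiles have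
  corners. The bridge is \<open>is_primitive u v\<close>: increments of the continuous u are
  integrals of v. For continuous u this is equivalent to v being a weak derivative; passing from the
  weak derivative to increments requires smooth test functions close to indicators of intervals,
  which is what the smooth step is for. The limit hypotheses concern u and not u', so the vanishing
  of the energy needs its own argument. In \<open>H1\<close>, with \<theta> = 2 arctan c, the jump
  condition at 0 reads cos \<theta> = -2/q. For c \<noteq> 0 one has 0 < |\<theta>| < pi, so |cos
  \<theta>| < 1: this is the origin of the threshold |q| > 2, and the half-angle formula turns the
  condition into c^2 = (q+2)/(q-2). For the limits 0 and 2 pi the slopes of the two halves agree at
  0 automatically, so sin(u(0)) = 0 as q \<noteq> 0, and pi is the only admissible value; this pins
  down the translate of the kink.\<close>

section \<open>Smooth functions and a smooth step\<close>

text \<open>Closed under derivatives, so every member is smooth. The generators are those needed for the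
  smooth step \<open>F x / (F x + F (1 - x))\<close> with \<open>F x = exp (- 1 / x)\<close> for \<open>x > 0\<close>.\<close>

inductive smooth_gen :: "(real \<Rightarrow> real) \<Rightarrow> bool" where
  flat: "smooth_gen (\<lambda>x. if x > 0 then poly p (1 / x) * exp (- (1 / x)) else 0)"
| const: "smooth_gen (\<lambda>x. c)"
| add: "smooth_gen f \<Longrightarrow> smooth_gen g \<Longrightarrow> smooth_gen (\<lambda>x. f x + g x)"
| mult: "smooth_gen f \<Longrightarrow> smooth_gen g \<Longrightarrow> smooth_gen (\<lambda>x. f x * g x)"
| inverse: "smooth_gen f \<Longrightarrow> (\<And>x. f x \<noteq> 0) \<Longrightarrow> smooth_gen (\<lambda>x. inverse (f x))"
| affine: "smooth_gen f \<Longrightarrow> smooth_gen (\<lambda>x. f (a + b * x))"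

lemma poly_times_exp_neg_tendsto_0:
  "((\<lambda>y. poly p y * exp (- y)) \<longlongrightarrow> (0::real)) at_top"
proof -
  have "((\<lambda>y. \<Sum>i\<le>degree p. coeff p i * (y ^ i / exp y)) \<longlongrightarrow> (\<Sum>i\<le>degree p. coeff p i * 0)) at_top"
    by (intro tendsto_intros tendsto_power_div_exp_0)
  then show ?thesis
    by (simp add: poly_altdef sum_distrib_right exp_minus divide_inverse mult.assoc)
qed

text \<open>The chain rule for 1/x contributes the factor 1/x^2, that is the polynomial
  \<open>[:0, 0, 1:]\<close> evaluated at 1/x, so the derivative keeps its shape with a new
  polynomial. At 0 the exponential beats every power of 1/h in the difference quotient.\<close>

lemma flat_has_derivative:
  fixes p :: "real poly"
  shows "((\<lambda>x. if x > 0 then poly p (1 / x) * exp (- (1 / x)) else 0) has_real_derivative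
     (if x > 0 then poly ((p - pderiv p) * [:0, 0, 1:]) (1 / x) * exp (- (1 / x)) else 0)) (at x)"
    (is "(?F p has_real_derivative ?D) (at x)")
proof -
  consider "x > 0" | "x < 0" | "x = 0" by linarith
  then show ?thesis
  proof cases
    case 1
    have "((\<lambda>x. poly p (1 / x) * exp (- (1 / x))) has_real_derivative ?D) (at x)"
      using 1 by (auto intro!: derivative_eq_intros DERIV_chain2[OF poly_DERIV]
          simp: field_simps power2_eq_square)
    moreover have "\<forall>\<^sub>F y in nhds x. (if y > 0 then poly p (1 / y) * exp (- (1 / y)) else 0)
        = poly p (1 / y) * exp (- (1 / y))"
      using eventually_nhds_in_open[of "{0<..}" x] 1 by (auto elim!: eventually_mono)
    ultimately show ?thesis by (subst DERIV_cong_ev[OF refl _ refl]) auto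
  next
    case 2
    have "\<forall>\<^sub>F y in nhds x. (if y > 0 then poly p (1 / y) * exp (- (1 / y)) else 0) = 0"
      using eventually_nhds_in_open[of "{..<0}" x] 2 by (auto elim!: eventually_mono)
    then show ?thesis using 2 by (subst DERIV_cong_ev[OF refl _ refl]) auto
  next
    case 3
    \<comment> \<open>Dividing by h is one more factor 1/h, hence the polynomial
      \<open>pCons 0 p\<close>.\<close>
    have "((\<lambda>h. poly (pCons 0 p) (inverse h) * exp (- inverse h)) \<longlongrightarrow> 0) (at_right 0)"
      using filterlim_compose[OF poly_times_exp_neg_tendsto_0 filterlim_inverse_at_top_right] .
    then have "((\<lambda>h. ?F p h / h) \<longlongrightarrow> 0) (at_right 0)"
      by (rule Lim_transform_eventually)
        (auto simp: eventually_at_right_less field_simps intro!: eventually_mono[OF eventually_at_right_less])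
    moreover have "((\<lambda>h. ?F p h / h) \<longlongrightarrow> 0) (at_left 0)"
      by (rule Lim_transform_eventually[OF tendsto_const])
        (auto simp: eventually_at_left_field intro!: exI[of _ "-1"])
    ultimately have "((\<lambda>h. ?F p h / h) \<longlongrightarrow> 0) (at 0)"
      by (rule filterlim_split_at_real[rotated])
    then show ?thesis using 3 by (simp add: has_field_derivative_iff)
  qed
qed

lemma smooth_gen_has_derivative:
  "smooth_gen f \<Longrightarrow> \<exists>f'. smooth_gen f' \<and> (\<forall>x. (f has_real_derivative f' x) (at x))"
proof (induction rule: smooth_gen.induct)
  case (flat p)
  show ?case using flat_has_derivative smooth_gen.flat by blast
next
  case (const c)
  show ?case by (rule exI[of _ "\<lambda>x. 0"]) (auto intro: smooth_gen.const)
next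
  case (add f g)
  then obtain f' g' where "smooth_gen f'" "\<forall>x. (f has_real_derivative f' x) (at x)"
    "smooth_gen g'" "\<forall>x. (g has_real_derivative g' x) (at x)" by blast
  then show ?case
    by (intro exI[of _ "\<lambda>x. f' x + g' x"]) (auto intro: smooth_gen.add DERIV_add)
next
  case (mult f g)
  then obtain f' g' where "smooth_gen f'" "\<forall>x. (f has_real_derivative f' x) (at x)"
    "smooth_gen g'" "\<forall>x. (g has_real_derivative g' x) (at x)" by blast
  then show ?case using mult.hyps
    by (intro exI[of _ "\<lambda>x. f' x * g x + g' x * f x"]) (auto intro!: smooth_gen.add smooth_gen.mult DERIV_mult)
next
  case (inverse f)
  then obtain f' where "smooth_gen f'" "\<forall>x. (f has_real_derivative f' x) (at x)" by blast
  then show ?case using inverse.hyps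
    by (intro exI[of _ "\<lambda>x. (- 1) * (f' x * (inverse (f x) * inverse (f x)))"] conjI allI
        smooth_gen.const smooth_gen.mult smooth_gen.inverse)
      (auto intro!: derivative_eq_intros simp: mult_ac)
next
  case (affine f a b)
  then obtain f' where "smooth_gen f'" "\<forall>x. (f has_real_derivative f' x) (at x)" by blast
  then show ?case
    by (intro exI[of _ "\<lambda>x. f' (a + b * x) * b"])
      (auto intro!: smooth_gen.const smooth_gen.mult smooth_gen.affine DERIV_chain2[of f] derivative_eq_intros)
qed

lemma smooth_gen_deriv: "smooth_gen f \<Longrightarrow> smooth_gen (deriv f)"
  using smooth_gen_has_derivative[of f] DERIV_imp_deriv[of f] by (metis ext)

lemma smooth_gen_differentiable:
  assumes "smooth_gen f"
  shows "(deriv ^^ n) f field_differentiable (at x)"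
proof -
  have "smooth_gen ((deriv ^^ n) f)"
    by (induction n) (auto intro: assms smooth_gen_deriv)
  then show ?thesis
    using smooth_gen_has_derivative by (auto simp: field_differentiable_def)
qed

text \<open>x and 1 - x are never both nonpositive, so the denominator \<open>D\<close> is positive
  and the generator \<open>inverse\<close> applies. Differences of translated and dilated copies of
  \<open>P\<close> serve as smooth approximations of indicators.\<close>

lemma smooth_step:
  obtains P where "smooth_gen P" "\<And>x. x \<le> 0 \<Longrightarrow> P x = 0" "\<And>x. x \<ge> 1 \<Longrightarrow> P x = 1"
    "\<And>x. 0 \<le> P x \<and> P x \<le> 1"
proof -
  define F where "F = (\<lambda>x::real. if x > 0 then poly 1 (1 / x) * exp (- (1 / x)) else 0)"
  define D where "D = (\<lambda>x. F x + F (1 + (- 1) * x))"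
  define P where "P = (\<lambda>x. F x * inverse (D x))"
  have F: "smooth_gen F" unfolding F_def by (rule smooth_gen.flat)
  have D: "smooth_gen D" unfolding D_def by (intro smooth_gen.add smooth_gen.affine F)
  have nn: "F x \<ge> 0" for x by (simp add: F_def)
  have pos: "D x > 0" for x
  proof (cases "x > 0")
    case True
    then have "F x > 0" by (simp add: F_def)
    then show ?thesis using nn[of "1 + (- 1) * x"] unfolding D_def by linarith
  next
    case False
    then have "F (1 + (- 1) * x) > 0" by (simp add: F_def)
    then show ?thesis using nn[of x] unfolding D_def by linarith
  qed
  show ?thesis
  proof
    show "smooth_gen P" unfolding P_def
      using pos by (intro smooth_gen.mult smooth_gen.inverse F D) (metis less_irrefl)
    show "P x = 0" if "x \<le> 0" for x using that by (simp add: P_def F_def)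
    show "P x = 1" if "x \<ge> 1" for x
    proof -
      have "D x = F x" using that by (simp add: D_def F_def)
      then show ?thesis using pos[of x] by (simp add: P_def)
    qed
    show "0 \<le> P x \<and> P x \<le> 1" for x
    proof -
      have "F x \<le> D x" using nn by (simp add: D_def)
      then show ?thesis using nn[of x] pos[of x] by (simp add: P_def field_simps)
    qed
  qed
qed


section \<open>Local integrability\<close>

lemma integrable_compact_support:
  fixes f :: "real \<Rightarrow> real"
  assumes "continuous_on {a..b} f" "\<And>x. x \<notin> {a..b} \<Longrightarrow> f x = 0"
  shows "integrable lborel f"
proof -
  have "(\<lambda>x. indicator {a..b} x *\<^sub>R f x) = f"
    using assms(2) by (intro ext) (metis indicator_simps(1,2) scaleR_one scaleR_zero_left)
  then show ?thesis
    using borel_integrable_atLeastAtMost'[OF assms(1)] by (simp add: set_integrable_def)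
qed

lemma integral_eq_set_integral_of_support:
  fixes f :: "real \<Rightarrow> real"
  assumes "\<And>x. x \<notin> A \<Longrightarrow> f x = 0"
  shows "(\<integral>x. f x \<partial>M) = (LINT x:A|M. f x)"
  unfolding set_lebesgue_integral_def
  by (rule Bochner_Integration.integral_cong) (use assms in \<open>auto simp: indicator_def\<close>)

lemma locally_integrableD: "locally_integrable f \<Longrightarrow> set_integrable lborel {a..b} f"
  by (simp add: locally_integrable_def)

lemma locally_integrable_continuous: "continuous_on UNIV f \<Longrightarrow> locally_integrable f"
  unfolding locally_integrable_def
  by (auto intro!: borel_integrable_atLeastAtMost' intro: continuous_on_subset)

lemma locally_integrable_measurable:
  assumes "locally_integrable f"
  shows "f \<in> borel_measurable borel"
proof (rule borel_measurable_LIMSEQ_real)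
  show "(\<lambda>x. indicator {- real n..real n} x * f x) \<in> borel_measurable borel" for n
    using assms borel_measurable_integrable[of lborel "\<lambda>x. indicator {- real n..real n} x * f x"]
    by (simp add: locally_integrable_def set_integrable_def)
  fix x :: real
  obtain N where "\<bar>x\<bar> \<le> real N" using real_arch_simple by blast
  then have "\<forall>\<^sub>F n in sequentially. indicator {- real n..real n} x * f x = f x"
    by (intro eventually_sequentiallyI[of N]) (auto simp: indicator_def abs_le_iff)
  then show "(\<lambda>n. indicator {- real n..real n} x * f x) \<longlonglongrightarrow> f x"
    by (rule tendsto_eventually)
qed

lemma locally_integrable_mult:
  assumes u: "continuous_on UNIV u" and v: "locally_integrable v"
  shows "locally_integrable (\<lambda>x. u x * v x)"
  unfolding locally_integrable_def
proof safe
  fix a b :: real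
  have "compact (u ` {a..b})"
    by (intro compact_continuous_image) (auto intro: continuous_on_subset[OF u])
  then obtain M where M: "\<And>x. x \<in> {a..b} \<Longrightarrow> \<bar>u x\<bar> \<le> M"
    using compact_imp_bounded[of "u ` {a..b}"] by (fastforce simp: bounded_iff)
  have [measurable]: "u \<in> borel_measurable borel" "v \<in> borel_measurable borel"
    using u v by (auto intro: borel_measurable_continuous_onI locally_integrable_measurable)
  have i: "integrable lborel (\<lambda>x. M * (indicator {a..b} x * \<bar>v x\<bar>))"
    using set_integrable_abs[OF locally_integrableD[OF v, of a b]] by (simp add: set_integrable_def)
  show "set_integrable lborel {a..b} (\<lambda>x. u x * v x)"
    unfolding set_integrable_def
  proof (rule Bochner_Integration.integrable_bound[OF i])
    show "AE x in lborel. norm (indicator {a..b} x *\<^sub>R (u x * v x))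
       \<le> norm (M * (indicator {a..b} x * \<bar>v x\<bar>))"
    proof (rule AE_I2)
      fix x :: real
      show "norm (indicator {a..b} x *\<^sub>R (u x * v x)) \<le> norm (M * (indicator {a..b} x * \<bar>v x\<bar>))"
      proof (cases "x \<in> {a..b}")
        case True
        then have "\<bar>u x\<bar> \<le> \<bar>M\<bar>" using M[of x] by linarith
        then show ?thesis using True by (auto simp: abs_mult intro!: mult_right_mono)
      qed auto
    qed
  qed measurable
qed

section \<open>Primitives of locally integrable functions\<close>

text \<open>Local absolute continuity with a.e. derivative v, in integrated form. No pointwise
  derivative is mentioned, so v may be a step function or any representative modulo null sets, as
  hat functions and \<open>weak_deriv\<close> require.\<close>

definition is_primitive :: "(real \<Rightarrow> real) \<Rightarrow> (real \<Rightarrow> real) \<Rightarrow> bool" where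
  "is_primitive u v \<longleftrightarrow> continuous_on UNIV u \<and> locally_integrable v \<and>
     (\<forall>a b. a \<le> b \<longrightarrow> (LINT x:{a..b}|lborel. v x) = u b - u a)"

lemma is_primitiveD:
  assumes "is_primitive u v"
  shows "continuous_on UNIV u" "locally_integrable v" "a \<le> b \<Longrightarrow> (LINT x:{a..b}|lborel. v x) = u b - u a"
  using assms by (auto simp: is_primitive_def)

lemma is_primitive_C1:
  assumes d: "\<And>x. (f has_real_derivative f' x) (at x)" and c: "continuous_on UNIV f'"
  shows "is_primitive f f'"
  unfolding is_primitive_def
proof (intro conjI allI impI)
  show "continuous_on UNIV f"
    using d by (intro continuous_at_imp_continuous_on) (auto intro: DERIV_isCont)
  show "locally_integrable f'" using c by (rule locally_integrable_continuous)
  fix a b :: real assume "a \<le> b"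
  then show "(LINT x:{a..b}|lborel. f' x) = f b - f a"
    unfolding set_lebesgue_integral_def
    by (intro integral_FTC_atLeastAtMost)
      (auto intro: continuous_on_subset[OF c] has_vector_derivative_at_within
        d[unfolded has_real_derivative_iff_has_vector_derivative])
qed

lemma is_primitive_add:
  assumes "is_primitive u v" "is_primitive w z"
  shows "is_primitive (\<lambda>x. u x + w x) (\<lambda>x. v x + z x)"
  using assms unfolding is_primitive_def locally_integrable_def
  by (auto intro!: continuous_intros set_integral_add)

lemma is_primitive_cmult:
  assumes "is_primitive u v"
  shows "is_primitive (\<lambda>x. c * u x) (\<lambda>x. c * v x)"
  using assms unfolding is_primitive_def locally_integrable_def
  by (auto intro!: continuous_intros simp: right_diff_distrib)

lemma is_primitive_diff:
  assumes "is_primitive u v" "is_primitive w z"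
  shows "is_primitive (\<lambda>x. u x - w x) (\<lambda>x. v x - z x)"
  using is_primitive_add[OF assms(1) is_primitive_cmult[OF assms(2), of "-1"]] by simp

text \<open>Building block for hat functions, each of which is a combination of two clamps and a
  constant.\<close>

lemma is_primitive_clamp:
  assumes "a \<le> b"
  shows "is_primitive (\<lambda>x. max a (min x b)) (indicator {a..b})"
  unfolding is_primitive_def
proof (intro conjI allI impI)
  show "continuous_on UNIV (\<lambda>x. max a (min x b))" by (intro continuous_intros)
  have eq: "(\<lambda>x. indicator {s..t} x * indicator {a..b} x :: real) = indicator {max s a..min t b}" for s t
    by (auto simp: indicator_def)
  show "locally_integrable (indicator {a..b})"
    by (auto simp: locally_integrable_def set_integrable_def eq emeasure_lborel_Icc_eq
        intro!: integrable_real_indicator)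
  fix s t :: real assume "s \<le> t"
  then show "(LINT x:{s..t}|lborel. indicator {a..b} x) = max a (min t b) - max a (min s b)"
    using assms by (auto simp: set_lebesgue_integral_def eq max_def min_def)
qed

section \<open>Weak derivatives of continuous functions\<close>

text \<open>An approximate identity sitting to the right of \<open>c\<close>. After the substitution
  t = (n+1)(x - c) only values of u on [c, c+1] enter, where u is bounded by compactness, so
  dominated convergence applies.\<close>

lemma rescaled_bump_tendsto:
  fixes u B :: "real \<Rightarrow> real"
  assumes u: "continuous_on UNIV u" and B: "continuous_on UNIV B"
    and supp: "\<And>x. x \<notin> {0..1} \<Longrightarrow> B x = 0" and one: "(\<integral>x. B x \<partial>lborel) = 1"
  shows "(\<lambda>n. \<integral>x. u x * (real (Suc n) * B (real (Suc n) * (x - c))) \<partial>lborel) \<longlonglongrightarrow> u c"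
proof -
  have [measurable]: "u \<in> borel_measurable borel" "B \<in> borel_measurable borel"
    using u B by (auto intro: borel_measurable_continuous_onI)
  have eq: "(\<integral>x. u x * (real (Suc n) * B (real (Suc n) * (x - c))) \<partial>lborel)
      = (\<integral>t. u (c + t / real (Suc n)) * B t \<partial>lborel)" for n
  proof -
    let ?N = "real (Suc n)"
    have "(\<integral>x. u x * (?N * B (?N * (x - c))) \<partial>lborel)
        = \<bar>1 / ?N\<bar> *\<^sub>R (\<integral>t. u (c + 1 / ?N * t) * (?N * B (?N * (c + 1 / ?N * t - c))) \<partial>lborel)"
      by (rule lborel_integral_real_affine) simp
    also have "\<dots> = (\<integral>t. 1 / ?N * (u (c + 1 / ?N * t) * (?N * B (?N * (c + 1 / ?N * t - c)))) \<partial>lborel)"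
      by (simp only: Bochner_Integration.integral_mult_right_zero) simp
    also have "(\<lambda>t. 1 / ?N * (u (c + 1 / ?N * t) * (?N * B (?N * (c + 1 / ?N * t - c)))))
        = (\<lambda>t. u (c + t / ?N) * B t)"
      by (rule ext) (simp del: of_nat_Suc)
    finally show ?thesis .
  qed
  have "compact (u ` {c..c+1})" 
    by (intro compact_continuous_image) (auto intro: continuous_on_subset[OF u])
  then obtain M where M: "\<And>x. x \<in> {c..c+1} \<Longrightarrow> \<bar>u x\<bar> \<le> M"
    using compact_imp_bounded[of "u ` {c..c+1}"] by (fastforce simp: bounded_iff)
  have "(\<lambda>n. \<integral>t. u (c + t / real (Suc n)) * B t \<partial>lborel) \<longlonglongrightarrow> (\<integral>t. u c * B t \<partial>lborel)"
  proof (rule integral_dominated_convergence)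
    have "integrable lborel (\<lambda>t. \<bar>B t\<bar>)"
      using supp by (intro integrable_compact_support[of 0 1] continuous_intros
         continuous_on_subset[OF B]) auto
    then show "integrable lborel (\<lambda>t. M * \<bar>B t\<bar>)" by simp
    show "AE t in lborel. (\<lambda>n. u (c + t / real (Suc n)) * B t) \<longlonglongrightarrow> u c * B t"
    proof (rule AE_I2)
      fix t
      have "(\<lambda>n. t * (1 / real (Suc n))) \<longlonglongrightarrow> t * 0"
        by (intro tendsto_intros lim_1_over_n[THEN LIMSEQ_Suc])
      then have l: "(\<lambda>n. c + t / real (Suc n)) \<longlonglongrightarrow> c"
        using tendsto_add[OF tendsto_const[of c]] by fastforce
      have "isCont u c" using u by (simp add: continuous_on_eq_continuous_at)
      then show "(\<lambda>n. u (c + t / real (Suc n)) * B t) \<longlonglongrightarrow> u c * B t"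
        by (intro tendsto_intros isCont_tendsto_compose[of c u] l)
    qed
    show "AE t in lborel. norm (u (c + t / real (Suc n)) * B t) \<le> M * \<bar>B t\<bar>" for n
    proof (rule AE_I2)
      fix t
      show "norm (u (c + t / real (Suc n)) * B t) \<le> M * \<bar>B t\<bar>"
      proof (cases "t \<in> {0..1}")
        case True
        then have "t / real (Suc n) \<le> 1" by (auto simp: field_simps)
        then have "c + t / real (Suc n) \<in> {c..c+1}" using True by auto
        then show ?thesis using M by (auto simp: abs_mult intro!: mult_right_mono)
      qed (use supp in auto)
    qed
  qed measurable
  then show ?thesis unfolding eq using one by simp
qed

text \<open>The test functions are smooth plateaus: a steep step up at \<open>a\<close> minus one at
  \<open>b\<close>. Their derivatives are differences of approximate identities at \<open>a\<close>
  and \<open>b\<close>, so one side of the weak identity tends to u(a) - u(b), while the plateaus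
  themselves tend to the indicator of (a, b].\<close>

lemma weak_deriv_imp_is_primitive:
  assumes u: "continuous_on UNIV u" and w: "has_weak_deriv u v"
  shows "is_primitive u v"
proof -
  have v: "locally_integrable v" using w by (simp add: has_weak_deriv_def)
  have [measurable]: "v \<in> borel_measurable borel" by (rule locally_integrable_measurable[OF v])
  obtain P where P: "smooth_gen P" and P0: "\<And>x. x \<le> 0 \<Longrightarrow> P x = 0" and P1: "\<And>x. x \<ge> 1 \<Longrightarrow> P x = 1"
    and P01: "\<And>x. 0 \<le> P x \<and> P x \<le> 1" using smooth_step by metis
  obtain B where B: "smooth_gen B" and PB: "\<And>x. (P has_real_derivative B x) (at x)"
    using smooth_gen_has_derivative[OF P] by blast
  have cB: "continuous_on UNIV B" using smooth_gen_has_derivative[OF B]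
    by (meson DERIV_isCont continuous_at_imp_continuous_on)
  have cP: "continuous_on UNIV P" using PB
    by (meson DERIV_isCont continuous_at_imp_continuous_on)
  then have [measurable]: "P \<in> borel_measurable borel" by (rule borel_measurable_continuous_onI)
  have supp: "B x = 0" if "x \<notin> {0..1}" for x
  proof (cases "x < 0")
    case True
    then have "\<forall>\<^sub>F y in nhds x. P y = 0"
      using eventually_nhds_in_open[of "{..<0}" x] by (auto elim!: eventually_mono intro: P0)
    then have "(P has_real_derivative 0) (at x)" by (subst DERIV_cong_ev[OF refl _ refl]) auto
    then show ?thesis using PB DERIV_unique by blast
  next
    case False
    then have "\<forall>\<^sub>F y in nhds x. P y = 1"
      using eventually_nhds_in_open[of "{1<..}" x] that by (auto elim!: eventually_mono intro: P1)
    then have "(P has_real_derivative 0) (at x)" by (subst DERIV_cong_ev[OF refl _ refl]) auto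
    then show ?thesis using PB DERIV_unique by blast
  qed
  have one: "(\<integral>x. B x \<partial>lborel) = 1"
    using integral_eq_set_integral_of_support[of "{0..1}" B lborel] supp
      is_primitiveD(3)[OF is_primitive_C1[OF PB cB], of 0 1] P0[of 0] P1[of 1] by simp
  have "(LINT x:{a..b}|lborel. v x) = u b - u a" if "a \<le> b" for a b
  proof -
    let ?N = "\<lambda>n. real (Suc n)"
    define \<phi> where "\<phi> n x = P (?N n * (x - a)) - P (?N n * (x - b))" for n x
    define D where "D n c x = ?N n * B (?N n * (x - c))" for n c x
    have \<phi>D: "(\<phi> n has_real_derivative D n a x - D n b x) (at x)" for n x
      unfolding \<phi>_def D_def
      by (auto intro!: derivative_eq_intros DERIV_chain2[OF PB])
    \<comment> \<open>Since \<open>Suc n\<close> is at least 1, both steps are complete one unit to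
      the right of \<open>b\<close>; the support bound is thus independent of n and yields the
      dominating function.\<close>
    have \<phi>0: "\<phi> n x = 0" if "x \<notin> {a..b+1}" for n x
    proof (cases "x < a")
      case True
      then have "?N n * (x - a) \<le> 0" "?N n * (x - b) \<le> 0"
        using \<open>a \<le> b\<close> by (auto intro!: mult_nonneg_nonpos simp del: of_nat_Suc)
      then show ?thesis by (simp add: \<phi>_def P0 del: of_nat_Suc)
    next
      case False
      then have "1 * 1 \<le> ?N n * (x - a)" "1 * 1 \<le> ?N n * (x - b)"
        using \<open>a \<le> b\<close> that by (intro mult_mono; auto)+
      then show ?thesis by (simp add: \<phi>_def P1 del: of_nat_Suc)
    qed
    have sg: "smooth_gen (\<phi> n)" for n
    proof -
      have "smooth_gen (\<lambda>x. P (- (?N n * a) + ?N n * x) + (- 1) * P (- (?N n * b) + ?N n * x))"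
        by (intro smooth_gen.add smooth_gen.mult smooth_gen.const smooth_gen.affine[OF P])
      moreover have "(\<lambda>x. P (- (?N n * a) + ?N n * x) + (- 1) * P (- (?N n * b) + ?N n * x)) = \<phi> n"
        by (auto simp: \<phi>_def right_diff_distrib simp del: of_nat_Suc)
      ultimately show ?thesis by simp
    qed
    have tf: "test_function (\<phi> n)" for n
    proof -
      have "closure {x. \<phi> n x \<noteq> 0} \<subseteq> {a..b+1}"
        using \<phi>0[of _ n] by (intro closure_minimal subsetI) (blast, simp)
      then have "compact (closure {x. \<phi> n x \<noteq> 0})"
        by (metis closed_closure compact_Icc compact_Int_closed inf.absorb_iff2)
      then show ?thesis unfolding test_function_def using smooth_gen_differentiable[OF sg] by blast
    qed
    have wk: "(\<integral>x. u x * D n a x \<partial>lborel) - (\<integral>x. u x * D n b x \<partial>lborel) = - (\<integral>x. v x * \<phi> n x \<partial>lborel)" for n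
    proof -
      have i: "integrable lborel (\<lambda>x. u x * D n c x)" for c
      proof (rule integrable_compact_support[of c "c+1"])
        show "continuous_on {c..c+1} (\<lambda>x. u x * D n c x)" unfolding D_def
          by (intro continuous_intros continuous_on_subset[OF u] continuous_on_compose2[OF cB]) auto
        show "u x * D n c x = 0" if "x \<notin> {c..c+1}" for x
        proof -
          have "?N n * (x - c) \<notin> {0..1}"
          proof (cases "x < c")
            case True
            then have "?N n * (x - c) < 0" by (intro mult_pos_neg) auto
            then show ?thesis by auto
          next
            case False
            then have "1 < x - c" using that by auto
            also have "x - c \<le> ?N n * (x - c)"
              using mult_right_mono[of 1 "?N n" "x - c"] False by simp
            finally show ?thesis by auto
          qed
          then show ?thesis using supp by (simp add: D_def del: of_nat_Suc)
        qed
      qed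
      have "deriv (\<phi> n) = (\<lambda>x. D n a x - D n b x)"
        using \<phi>D by (auto intro!: ext DERIV_imp_deriv)
      then have "(\<integral>x. u x * (D n a x - D n b x) \<partial>lborel) = - (\<integral>x. v x * \<phi> n x \<partial>lborel)"
        using w tf[of n] unfolding has_weak_deriv_def by metis
      then show ?thesis using i[of a] i[of b] by (simp add: right_diff_distrib)
    qed
    have "(\<lambda>n. (\<integral>x. u x * D n a x \<partial>lborel) - (\<integral>x. u x * D n b x \<partial>lborel)) \<longlonglongrightarrow> u a - u b"
      unfolding D_def by (intro tendsto_diff rescaled_bump_tendsto[OF u cB supp one])
    then have l1: "(\<lambda>n. - (\<integral>x. v x * \<phi> n x \<partial>lborel)) \<longlonglongrightarrow> u a - u b" unfolding wk .
    have "(\<lambda>n. \<integral>x. v x * \<phi> n x \<partial>lborel) \<longlonglongrightarrow> (\<integral>x. v x * indicator {a<..b} x \<partial>lborel)"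
    proof (rule integral_dominated_convergence)
      show "integrable lborel (\<lambda>x. indicator {a..b+1} x * \<bar>v x\<bar>)"
        using set_integrable_abs[OF locally_integrableD[OF v, of a "b+1"]] by (simp add: set_integrable_def)
      show "AE x in lborel. (\<lambda>n. v x * \<phi> n x) \<longlonglongrightarrow> v x * indicator {a<..b} x"
      proof (rule AE_I2)
        fix x
        \<comment> \<open>At x = c the argument is 0, where \<open>P\<close> vanishes; hence the
          strict inequality and the half-open limit interval.\<close>
        have lim: "(\<lambda>n. P (?N n * (x - c))) \<longlonglongrightarrow> (if x > c then 1 else 0)" for c
        proof (cases "x > c")
          case True
          obtain N where N: "1 / (x - c) \<le> real N" using real_arch_simple by blast
          have "P (?N n * (x - c)) = 1" if "n \<ge> N" for n
          proof (rule P1)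
            have "1 / (x - c) \<le> ?N n" using N that by linarith
            then show "1 \<le> ?N n * (x - c)" using True by (simp add: field_simps)
          qed
          then have "\<forall>\<^sub>F n in sequentially. P (?N n * (x - c)) = 1"
            by (intro eventually_sequentiallyI[of N]) 
          then show ?thesis using True by (simp add: tendsto_eventually del: of_nat_Suc)
        next
          case False
          then have "?N n * (x - c) \<le> 0" for n by (intro mult_nonneg_nonpos) auto
          then show ?thesis using False by (simp add: P0 del: of_nat_Suc)
        qed
        have "(\<lambda>n. v x * \<phi> n x) \<longlonglongrightarrow> v x * ((if x > a then 1 else 0) - (if x > b then 1 else 0))"
          unfolding \<phi>_def by (intro tendsto_intros lim)
        moreover have "(if x > a then 1 else 0) - (if x > b then 1 else 0) = (indicator {a<..b} x :: real)"
          using \<open>a \<le> b\<close> by (auto simp: indicator_def)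
        ultimately show "(\<lambda>n. v x * \<phi> n x) \<longlonglongrightarrow> v x * indicator {a<..b} x" by simp
      qed
      show "AE x in lborel. norm (v x * \<phi> n x) \<le> indicator {a..b+1} x * \<bar>v x\<bar>" for n
      proof (rule AE_I2)
        fix x
        have "\<bar>\<phi> n x\<bar> \<le> 1" using P01[of "?N n * (x - a)"] P01[of "?N n * (x - b)"]
          unfolding \<phi>_def by linarith
        then show "norm (v x * \<phi> n x) \<le> indicator {a..b+1} x * \<bar>v x\<bar>"
          using \<phi>0[of x n] by (cases "x \<in> {a..b+1}") (auto simp: abs_mult mult_left_le)
      qed
      show "(\<lambda>x. v x * \<phi> n x) \<in> borel_measurable lborel" for n unfolding \<phi>_def by measurable
    qed measurable
    then have "- (\<integral>x. v x * indicator {a<..b} x \<partial>lborel) = u a - u b"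
      using LIMSEQ_unique[OF l1 tendsto_minus] by metis
    moreover have "(\<integral>x. v x * indicator {a<..b} x \<partial>lborel) = (LINT x:{a..b}|lborel. v x)"
      unfolding set_lebesgue_integral_def
    proof (rule integral_cong_AE)
      show "AE x in lborel. v x * indicator {a<..b} x = indicator {a..b} x *\<^sub>R v x"
        using AE_lborel_singleton[of a] by eventually_elim (auto simp: indicator_def)
    qed measurable
    ultimately show ?thesis by simp
  qed
  then show ?thesis using u v by (simp add: is_primitive_def)
qed


section \<open>Integration by parts\<close>

text \<open>With v and z only locally integrable the product rule is proved in integrated form: one
  double integral equals both the integral of (u(t) - u(a)) z(t) and that of (w(b) - w(s)) v(s), and
  expanding the two gives the formula.\<close>

lemma is_primitive_mult:
  assumes uv: "is_primitive u v" and wz: "is_primitive w z"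
  shows "is_primitive (\<lambda>x. u x * w x) (\<lambda>x. u x * z x + w x * v x)"
proof -
  note u = is_primitiveD(1)[OF uv] and v = is_primitiveD(2)[OF uv]
  note w = is_primitiveD(1)[OF wz] and z = is_primitiveD(2)[OF wz]
  have uz: "locally_integrable (\<lambda>x. u x * z x)" and wv: "locally_integrable (\<lambda>x. w x * v x)"
    by (intro locally_integrable_mult u v w z)+
  have [measurable]: "v \<in> borel_measurable borel" "z \<in> borel_measurable borel"
    using v z by (auto intro: locally_integrable_measurable)
  have "(LINT x:{a..b}|lborel. u x * z x + w x * v x) = u b * w b - u a * w a" if ab: "a \<le> b" for a b
  proof -
    define V where "V s = indicator {a..b} s * v s" for s
    define Z where "Z t = indicator {a..b} t * z t" for t
    have [measurable]: "V \<in> borel_measurable borel" "Z \<in> borel_measurable borel"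
      unfolding V_def Z_def by measurable
    have iV: "integrable lborel V" and iZ: "integrable lborel Z"
      using locally_integrableD[OF v, of a b] locally_integrableD[OF z, of a b]
      unfolding V_def Z_def set_integrable_def by simp_all
    have iVZ: "integrable (lborel \<Otimes>\<^sub>M lborel) (\<lambda>(s, t). V s * Z t)"
    proof (rule lborel_pair.Fubini_integrable)
      show "(\<lambda>(s, t). V s * Z t) \<in> borel_measurable (lborel \<Otimes>\<^sub>M lborel)" by measurable
      show "integrable lborel (\<lambda>s. \<integral>t. norm (case (s, t) of (s, t) \<Rightarrow> V s * Z t) \<partial>lborel)"
        using iV by (simp add: abs_mult)
      show "AE s in lborel. integrable lborel (\<lambda>t. case (s, t) of (s, t) \<Rightarrow> V s * Z t)"
        using iZ by simp
    qed
    have i: "integrable (lborel \<Otimes>\<^sub>M lborel) (\<lambda>(s, t). of_bool (s \<le> t) * (V s * Z t))"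
    proof (rule Bochner_Integration.integrable_bound[OF iVZ])
      show "(\<lambda>(s, t). of_bool (s \<le> t) * (V s * Z t)) \<in> borel_measurable (lborel \<Otimes>\<^sub>M lborel)"
        unfolding of_bool_def by measurable
    qed (auto intro!: AE_I2)
    \<comment> \<open>Integrate \<open>v s * z t\<close> over the triangle \<open>a \<le> s \<le> t \<le> b\<close> in both orders.\<close>
    have F: "(\<integral>t. (\<integral>s. of_bool (s \<le> t) * (V s * Z t) \<partial>lborel) \<partial>lborel)
        = (\<integral>s. (\<integral>t. of_bool (s \<le> t) * (V s * Z t) \<partial>lborel) \<partial>lborel)"
      by (rule lborel_pair.Fubini_integral[OF i])
    have "(\<integral>s. of_bool (s \<le> t) * (V s * Z t) \<partial>lborel) = indicator {a..b} t * ((u t - u a) * z t)" for t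
    proof (cases "t \<in> {a..b}")
      case True
      have "(\<integral>s. of_bool (s \<le> t) * (V s * Z t) \<partial>lborel) = (\<integral>s. (indicator {a..t} s *\<^sub>R v s) * Z t \<partial>lborel)"
        using True by (intro Bochner_Integration.integral_cong refl) (auto simp: V_def indicator_def)
      also have "\<dots> = (u t - u a) * Z t"
        using is_primitiveD(3)[OF uv, of a t] True
        by (simp add: set_lebesgue_integral_def)
      finally show ?thesis using True by (simp add: Z_def)
    qed (simp add: Z_def)
    moreover have "(\<integral>t. of_bool (s \<le> t) * (V s * Z t) \<partial>lborel) = indicator {a..b} s * ((w b - w s) * v s)" for s
    proof (cases "s \<in> {a..b}")
      case True
      have "(\<integral>t. of_bool (s \<le> t) * (V s * Z t) \<partial>lborel) = (\<integral>t. V s * (indicator {s..b} t *\<^sub>R z t) \<partial>lborel)"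
        using True by (intro Bochner_Integration.integral_cong refl) (auto simp: Z_def indicator_def)
      also have "\<dots> = V s * (w b - w s)"
        using is_primitiveD(3)[OF wz, of s b] True
        by (simp add: set_lebesgue_integral_def)
      finally show ?thesis using True by (simp add: V_def)
    qed (simp add: V_def)
    ultimately have "(LINT t:{a..b}|lborel. (u t - u a) * z t) = (LINT s:{a..b}|lborel. (w b - w s) * v s)"
      using F by (simp add: set_lebesgue_integral_def)
    then have "(LINT t:{a..b}|lborel. u t * z t) - u a * (LINT t:{a..b}|lborel. z t)
        = w b * (LINT s:{a..b}|lborel. v s) - (LINT s:{a..b}|lborel. w s * v s)"
      using locally_integrableD[OF v, of a b] locally_integrableD[OF z, of a b]
        locally_integrableD[OF uz, of a b] locally_integrableD[OF wv, of a b]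
      by (simp add: left_diff_distrib)
    then show ?thesis
      using locally_integrableD[OF uz, of a b] locally_integrableD[OF wv, of a b]
        is_primitiveD(3)[OF uv ab] is_primitiveD(3)[OF wz ab]
      by (simp add: algebra_simps)
  qed
  moreover have "locally_integrable (\<lambda>x. u x * z x + w x * v x)"
    using uz wv by (auto simp: locally_integrable_def)
  ultimately show ?thesis
    using u w by (auto simp: is_primitive_def intro!: continuous_intros)
qed

text \<open>The two support conditions differ on purpose: \<open>w\<close> must vanish at both end
  points to kill the boundary terms, while \<open>z\<close> may be nonzero there, as the step
  derivative of a hat is.\<close>

lemma integral_by_parts_compact_support:
  assumes uv: "is_primitive u v" and wz: "is_primitive w z"
    and w0: "\<And>x. x \<notin> {a<..<b} \<Longrightarrow> w x = 0" and z0: "\<And>x. x \<notin> {a..b} \<Longrightarrow> z x = 0"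
  shows "(\<integral>x. u x * z x \<partial>lborel) = - (\<integral>x. v x * w x \<partial>lborel)"
proof (cases "a \<le> b")
  case True
  have uz: "locally_integrable (\<lambda>x. u x * z x)" and wv: "locally_integrable (\<lambda>x. w x * v x)"
    using uv wz by (auto intro!: locally_integrable_mult dest: is_primitiveD)
  have "(\<integral>x. u x * z x \<partial>lborel) = (LINT x:{a..b}|lborel. u x * z x)"
    using z0 by (intro integral_eq_set_integral_of_support) auto
  moreover have "(\<integral>x. v x * w x \<partial>lborel) = (LINT x:{a..b}|lborel. w x * v x)"
    using w0 by (subst integral_eq_set_integral_of_support[of "{a..b}"]) (auto simp: mult.commute)
  ultimately show ?thesis
    using is_primitiveD(3)[OF is_primitive_mult[OF uv wz] True] w0[of a] w0[of b]
      locally_integrableD[OF uz, of a b] locally_integrableD[OF wv, of a b] by simp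
next
  case False
  then have "w = (\<lambda>x. 0)" "z = (\<lambda>x. 0)" using w0 z0 by auto
  then show ?thesis by simp
qed

lemma is_primitive_imp_weak_deriv:
  assumes uv: "is_primitive u v"
  shows "has_weak_deriv u v"
  unfolding has_weak_deriv_def
proof (intro conjI allI impI)
  show "locally_integrable u" by (intro locally_integrable_continuous is_primitiveD(1)[OF uv])
  show "locally_integrable v" by (rule is_primitiveD(2)[OF uv])
  fix \<phi> assume t: "test_function \<phi>"
  have d1: "\<phi> field_differentiable (at x)" and d2: "deriv \<phi> field_differentiable (at x)" for x
    using t[unfolded test_function_def, THEN conjunct1, rule_format, of 0 x]
      t[unfolded test_function_def, THEN conjunct1, rule_format, of 1 x] by simp_all
  have d: "(\<phi> has_real_derivative deriv \<phi> x) (at x)" for x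
    using d1 by (simp add: field_differentiable_derivI)
  have c: "continuous_on UNIV (deriv \<phi>)"
    using d2 by (auto intro!: continuous_at_imp_continuous_on field_differentiable_imp_continuous_at)
  obtain R where R: "\<And>x. \<phi> x \<noteq> 0 \<Longrightarrow> \<bar>x\<bar> \<le> R"
  proof -
    have "bounded {x. \<phi> x \<noteq> 0}"
      using t closure_subset bounded_subset compact_imp_bounded unfolding test_function_def by metis
    then show ?thesis using that by (auto simp: bounded_iff)
  qed
  \<comment> \<open>Widening by 1 puts the end points outside the support, as integration by parts
    demands.\<close>
  have z: "\<phi> x = 0" if "x \<notin> {- R - 1<..<R + 1}" for x
    using R[of x] that by (cases "\<phi> x = 0") auto
  have "deriv \<phi> x = 0" if "x \<notin> {- R - 1..R + 1}" for x
  proof -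
    have "open (- {- R - 1..R + 1})" by auto
    then have "\<forall>\<^sub>F y in nhds x. y \<in> - {- R - 1..R + 1}"
      using that by (intro eventually_nhds_in_open) auto
    then have "\<forall>\<^sub>F y in nhds x. \<phi> y = 0"
      by eventually_elim (rule z, auto)
    then have "(\<phi> has_real_derivative 0) (at x)" by (subst DERIV_cong_ev[OF refl _ refl]) auto
    then show ?thesis using DERIV_imp_deriv by blast
  qed
  then show "(\<integral>x. u x * deriv \<phi> x \<partial>lborel) = - (\<integral>x. v x * \<phi> x \<partial>lborel)"
    using integral_by_parts_compact_support[OF uv is_primitive_C1[OF d c] z] by blast
qed

section \<open>Almost everywhere uniqueness and the chosen weak derivative\<close>

text \<open>The positive and negative parts of f are densities of finite measures that agree on all
  rays. Rays determine such measures, and equal measures have a.e. equal densities.\<close>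

lemma AE_eq_0_if_integrals_eq_0:
  fixes f :: "real \<Rightarrow> real"
  assumes f: "integrable lborel f" and z: "\<And>x. (LINT t:{x<..}|lborel. f t) = 0"
  shows "AE x in lborel. f x = 0"
proof -
  have [measurable]: "f \<in> borel_measurable borel" using f by auto
  define p where "p x = max (f x) 0" for x
  define m where "m x = max (- f x) 0" for x
  have [measurable]: "p \<in> borel_measurable borel" "m \<in> borel_measurable borel"
    unfolding p_def m_def by measurable
  have pm: "0 \<le> p x" "0 \<le> m x" for x by (simp_all add: p_def m_def)
  have ip: "integrable lborel p" and im: "integrable lborel m"
    using f unfolding p_def m_def by auto
  have sp: "set_integrable lborel {x<..} p" "set_integrable lborel {x<..} m" for x
    using ip im by (auto simp: set_integrable_def intro!: integrable_mult_indicator[where 'b=real, simplified])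
  have nn: "(\<integral>\<^sup>+ t. ennreal (g t) * indicator {x<..} t \<partial>lborel) = ennreal (LINT t:{x<..}|lborel. g t)"
    if "set_integrable lborel {x<..} g" "\<And>t. 0 \<le> g t" for g :: "real \<Rightarrow> real" and x
    unfolding set_lebesgue_integral_def
    using that by (subst nn_integral_eq_integral[symmetric])
      (auto simp: set_integrable_def indicator_def intro!: nn_integral_cong)
  have "density lborel p = density lborel m"
  proof (rule measure_eqI_lessThan)
    fix x
    show "emeasure (density lborel p) {x<..} < \<infinity>"
      by (subst emeasure_density) (auto simp: nn[OF sp(1)] pm)
    have "(LINT t:{x<..}|lborel. p t) - (LINT t:{x<..}|lborel. m t) = (LINT t:{x<..}|lborel. f t)"
      using sp by (subst set_integral_diff(2)[symmetric]) (auto simp: p_def m_def max_def intro!: set_lebesgue_integral_cong)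
    then have "(LINT t:{x<..}|lborel. p t) = (LINT t:{x<..}|lborel. m t)" using z by simp
    then show "emeasure (density lborel p) {x<..} = emeasure (density lborel m) {x<..}"
      by (simp add: emeasure_density nn[OF sp(1)] nn[OF sp(2)] pm)
  qed auto
  then have "AE x in lborel. ennreal (p x) = ennreal (m x)"
    by (intro sigma_finite_measure.density_unique[OF sigma_finite_lborel]) auto
  then show ?thesis
    by eventually_elim (auto simp: p_def m_def max_def split: if_splits)
qed

text \<open>The difference v - v' is only locally integrable, so it is cut off to [-n, n]; its
  integral over a ray is then one over a compact interval, which is an increment of the zero
  function.\<close>

lemma is_primitive_unique_AE:
  assumes "is_primitive u v" "is_primitive u v'"
  shows "AE x in lborel. v x = v' x"
proof -
  have "is_primitive (\<lambda>x. 0) (\<lambda>x. v x - v' x)"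
    using is_primitive_diff[OF assms] by simp
  note P = is_primitiveD(2)[OF this] is_primitiveD(3)[OF this]
  have "AE x in lborel. indicator {- real n..real n} x * (v x - v' x) = 0" for n
  proof (rule AE_eq_0_if_integrals_eq_0)
    show "integrable lborel (\<lambda>x. indicator {- real n..real n} x * (v x - v' x))"
      using locally_integrableD[OF P(1), of "- real n" "real n"] by (simp add: set_integrable_def)
    fix x
    let ?a = "max x (- real n)"
    have "(LINT t:{x<..}|lborel. indicator {- real n..real n} t * (v t - v' t))
       = (LINT t:{?a..real n}|lborel. v t - v' t)"
      unfolding set_lebesgue_integral_def
    proof (rule integral_cong_AE)
      have [measurable]: "(\<lambda>t. v t - v' t) \<in> borel_measurable borel"
        by (rule locally_integrable_measurable[OF P(1)])
      show "(\<lambda>t. indicator {x<..} t *\<^sub>R (indicator {- real n..real n} t * (v t - v' t))) \<in> borel_measurable lborel"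
        "(\<lambda>t. indicator {?a..real n} t *\<^sub>R (v t - v' t)) \<in> borel_measurable lborel"
        by measurable
      show "AE t in lborel. indicator {x<..} t *\<^sub>R (indicator {- real n..real n} t * (v t - v' t))
          = indicator {?a..real n} t *\<^sub>R (v t - v' t)"
        using AE_lborel_singleton[of x] by eventually_elim (auto simp: indicator_def)
    qed
    also have "\<dots> = 0"
    proof (cases "?a \<le> real n")
      case True
      then show ?thesis using P(2)[of ?a "real n"] by simp
    qed (simp add: set_lebesgue_integral_def)
    finally show "(LINT t:{x<..}|lborel. indicator {- real n..real n} t * (v t - v' t)) = 0" .
  qed
  then have "AE x in lborel. \<forall>n. indicator {- real n..real n} x * (v x - v' x) = 0"
    unfolding AE_all_countable by blast
  then show ?thesis
  proof eventually_elim
    case (elim x)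
    obtain n where "\<bar>x\<bar> \<le> real n" using real_arch_simple by blast
    then show ?case using elim[rule_format, of n] by (auto simp: indicator_def abs_le_iff)
  qed
qed

lemma L2_cong_AE:
  assumes "f \<in> L2" "g \<in> borel_measurable borel" "AE x in lborel. g x = f x"
  shows "g \<in> L2"
proof -
  have [measurable]: "f \<in> borel_measurable borel" "g \<in> borel_measurable borel"
    using assms by (auto simp: L2_def)
  have "integrable lborel (\<lambda>x. (f x)\<^sup>2)" using assms by (simp add: L2_def)
  moreover have "AE x in lborel. (g x)\<^sup>2 = (f x)\<^sup>2" using assms(3) by eventually_elim simp
  ultimately have "integrable lborel (\<lambda>x. (g x)\<^sup>2)"
    by (subst integrable_cong_AE) auto
  then show ?thesis by (simp add: L2_def)
qed

lemma L2_mult_integrable: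
  assumes "f \<in> L2" "g \<in> L2"
  shows "integrable lborel (\<lambda>x. f x * g x)"
proof (rule Bochner_Integration.integrable_bound)
  show "integrable lborel (\<lambda>x. (f x)\<^sup>2 + (g x)\<^sup>2)" using assms by (simp add: L2_def)
  show "(\<lambda>x. f x * g x) \<in> borel_measurable lborel" using assms by (auto simp: L2_def)
  have "\<bar>a * b\<bar> \<le> a\<^sup>2 + b\<^sup>2" for a b :: real
  proof -
    have "0 \<le> \<bar>a\<bar> * \<bar>b\<bar>" by simp
    then show ?thesis
      using sum_squares_bound[of "\<bar>a\<bar>" "\<bar>b\<bar>"] by (simp only: abs_mult power2_abs)
  qed
  then show "AE x in lborel. norm (f x * g x) \<le> norm ((f x)\<^sup>2 + (g x)\<^sup>2)"
    by (auto intro!: AE_I2)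
qed

text \<open>The choice made by \<open>weak_deriv\<close> ranges over all weak derivatives, so its
  square integrability is not immediate. It is inherited from the \<open>L2\<close> witness, with
  which the choice agrees a.e.\<close>

lemma Hdot1_weak_deriv:
  assumes "u \<in> Hdot1"
  shows "is_primitive u (weak_deriv u)" "weak_deriv u \<in> L2"
proof -
  obtain v where u: "continuous_on UNIV u" and v: "v \<in> L2" "has_weak_deriv u v"
    using assms by (auto simp: Hdot1_def)
  have "has_weak_deriv u (weak_deriv u)" unfolding weak_deriv_def using v(2) by (rule someI[where P = "has_weak_deriv u"])
  then show P: "is_primitive u (weak_deriv u)" by (rule weak_deriv_imp_is_primitive[OF u])
  show "weak_deriv u \<in> L2"
    by (rule L2_cong_AE[OF v(1) locally_integrable_measurable[OF is_primitiveD(2)[OF P]]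
          is_primitive_unique_AE[OF P weak_deriv_imp_is_primitive[OF u v(2)]]])
qed

lemma Hdot1I:
  assumes "is_primitive u v" "v \<in> L2"
  shows "u \<in> Hdot1" "AE x in lborel. weak_deriv u x = v x"
proof -
  show u: "u \<in> Hdot1"
    using assms is_primitive_imp_weak_deriv[OF assms(1)] is_primitiveD(1)[OF assms(1)]
    by (auto simp: Hdot1_def)
  show "AE x in lborel. weak_deriv u x = v x"
    by (rule is_primitive_unique_AE[OF Hdot1_weak_deriv(1)[OF u] assms(1)])
qed

section \<open>Decay at infinity of functions in \<open>H1\<close>\<close>

lemma sliding_integral_tendsto_0:
  fixes G :: "real \<Rightarrow> real"
  assumes G: "integrable lborel G"
  shows "((\<lambda>x. LINT t:{x..x+1}|lborel. G t) \<longlongrightarrow> 0) at_top"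
proof -
  have [measurable]: "G \<in> borel_measurable borel" using G by auto
  have "((\<lambda>x. \<integral>t. indicator {x..x+1} t * G t \<partial>lborel) \<longlongrightarrow> (\<integral>t. 0 \<partial>(lborel :: real measure))) at_top"
  proof (rule integral_dominated_convergence_at_top)
    show "integrable lborel (\<lambda>t. \<bar>G t\<bar>)" using G by simp
    show "AE t in lborel. ((\<lambda>x. indicator {x..x+1} t * G t) \<longlongrightarrow> 0) at_top"
    proof (rule AE_I2)
      fix t
      have "\<forall>\<^sub>F x in at_top. indicator {x..x+1} t * G t = 0"
        using eventually_gt_at_top[of t] by eventually_elim (auto simp: indicator_def)
      then show "((\<lambda>x. indicator {x..x+1} t * G t) \<longlongrightarrow> 0) at_top" by (rule tendsto_eventually)
    qed
    show "\<forall>\<^sub>F x in at_top. AE t in lborel. norm (indicator {x..x+1} t * G t) \<le> \<bar>G t\<bar>"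
      by (intro always_eventually allI AE_I2) (auto simp: indicator_def)
  qed measurable
  then show ?thesis by (simp add: set_lebesgue_integral_def)
qed

lemma is_primitive_reflect:
  assumes "is_primitive u v"
  shows "is_primitive (\<lambda>x. u (- x)) (\<lambda>x. - v (- x))"
proof -
  have eq: "(\<integral>x. indicator {a..b} x * v (- x) \<partial>lborel) = (\<integral>x. indicator {-b..-a} x * v x \<partial>lborel)" for a b
    by (subst lborel_integral_real_affine[of "-1" _ 0])
      (auto intro!: Bochner_Integration.integral_cong simp: indicator_def)
  have i: "integrable lborel (\<lambda>x. indicator {a..b} x * v (- x))" for a b
  proof -
    have "integrable lborel (\<lambda>x. indicator {-b..-a} (0 + (-1) * x) * v (0 + (-1) * x))"
      using locally_integrableD[OF is_primitiveD(2)[OF assms], of "-b" "-a"]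
      by (intro lborel_integrable_real_affine[of "\<lambda>x. indicator {-b..-a} x * v x" "-1" 0]) (auto simp: set_integrable_def)
    moreover have "(\<lambda>x. indicator {-b..-a} (0 + (-1) * x) * v (0 + (-1) * x)) = (\<lambda>x. indicator {a..b} x * v (- x))"
      by (auto simp: indicator_def)
    ultimately show ?thesis by simp
  qed
  show ?thesis
    unfolding is_primitive_def
  proof (intro conjI allI impI)
    show "continuous_on UNIV (\<lambda>x. u (- x))"
      by (intro continuous_on_compose2[OF is_primitiveD(1)[OF assms]] continuous_intros) auto
    show "locally_integrable (\<lambda>x. - v (- x))"
      using i by (simp add: locally_integrable_def set_integrable_def)
    fix a b :: real assume "a \<le> b"
    then show "(LINT x:{a..b}|lborel. - v (- x)) = u (- b) - u (- a)"
      using is_primitiveD(3)[OF assms, of "-b" "-a"] eq[of a b]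
      by (simp add: set_lebesgue_integral_def)
  qed
qed

lemma L2_reflect:
  assumes "f \<in> L2"
  shows "(\<lambda>x. f (- x)) \<in> L2"
  using assms lborel_integrable_real_affine[of "\<lambda>x. (f x)\<^sup>2" "-1" 0] by (auto simp: L2_def)

text \<open>The square of u has the integrable derivative 2uv, whereas v itself need not be
  integrable. Comparing u(x)^2 with u(t)^2 for t in [x, x+1] and averaging over t bounds it by the
  integral of \<open>G\<close> over that window, which tends to 0.\<close>

lemma primitive_L2_tendsto_0_at_top:
  assumes uv: "is_primitive u v" and u: "u \<in> L2" and v: "v \<in> L2"
  shows "(u \<longlongrightarrow> 0) at_top"
proof -
  define G where "G x = (u x)\<^sup>2 + \<bar>2 * (u x * v x)\<bar>" for x
  have iuv: "integrable lborel (\<lambda>x. 2 * (u x * v x))" using L2_mult_integrable[OF u v] by simp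
  have iG: "integrable lborel G" unfolding G_def using u iuv by (auto simp: L2_def)
  have P: "is_primitive (\<lambda>x. u x * u x) (\<lambda>x. u x * v x + u x * v x)"
    by (rule is_primitive_mult[OF uv uv])
  have si: "set_integrable lborel A f" if "integrable lborel f" "A \<in> sets borel" for A and f :: "real \<Rightarrow> real"
    using that by (auto simp: set_integrable_def intro!: integrable_mult_indicator[where 'b=real, simplified])
  have bound: "(u x)\<^sup>2 \<le> (LINT t:{x..x+1}|lborel. G t)" for x
  proof -
    let ?K = "LINT t:{x..x+1}|lborel. \<bar>2 * (u t * v t)\<bar>"
    have iabs: "integrable lborel (\<lambda>t. \<bar>2 * (u t * v t)\<bar>)" using iuv by (rule integrable_abs)
    have le: "(u x)\<^sup>2 \<le> (u t)\<^sup>2 + ?K" if t: "t \<in> {x..x+1}" for t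
    proof -
      have "(u t)\<^sup>2 - (u x)\<^sup>2 = (LINT s:{x..t}|lborel. 2 * (u s * v s))"
        using is_primitiveD(3)[OF P, of x t] t by (simp add: power2_eq_square)
      moreover have "- (LINT s:{x..t}|lborel. 2 * (u s * v s)) \<le> (LINT s:{x..t}|lborel. \<bar>2 * (u s * v s)\<bar>)"
        using si[OF iuv, of "{x..t}"] si[OF iabs, of "{x..t}"]
        by (subst set_integral_uminus[symmetric]) (auto intro!: set_integral_mono simp: set_integrable_def)
      moreover have "(LINT s:{x..t}|lborel. \<bar>2 * (u s * v s)\<bar>) \<le> ?K"
        unfolding set_lebesgue_integral_def
        using si[OF iabs, of "{x..t}"] si[OF iabs, of "{x..x+1}"] t
        by (intro integral_mono) (auto simp: set_integrable_def indicator_def)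
      ultimately show ?thesis by linarith
    qed
    have iu2: "integrable lborel (\<lambda>t. (u t)\<^sup>2)" using u by (simp add: L2_def)
    have i1: "set_integrable lborel {x..x+1} (\<lambda>t. c)" for c :: real
      by (intro locally_integrableD locally_integrable_continuous) auto
    have c: "(LINT t:{x..x+1}|lborel. c) = c" for c :: real
      by (simp add: set_integral_const)
    have "(LINT t:{x..x+1}|lborel. (u x)\<^sup>2) \<le> (LINT t:{x..x+1}|lborel. (u t)\<^sup>2 + ?K)"
      using le i1 si[OF iu2, of "{x..x+1}"] by (intro set_integral_mono set_integral_add) auto
    also have "\<dots> = (LINT t:{x..x+1}|lborel. (u t)\<^sup>2) + ?K"
      using i1 si[OF iu2, of "{x..x+1}"] by (subst set_integral_add) (auto simp: c)
    also have "\<dots> = (LINT t:{x..x+1}|lborel. G t)"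
      unfolding G_def using si[OF iabs, of "{x..x+1}"] si[OF iu2, of "{x..x+1}"]
      by (subst set_integral_add) auto
    finally show ?thesis by (simp add: c)
  qed
  have "((\<lambda>x. (u x)\<^sup>2) \<longlongrightarrow> 0) at_top"
    by (rule tendsto_sandwich[OF _ _ tendsto_const sliding_integral_tendsto_0[OF iG]])
      (use bound in \<open>auto intro!: always_eventually\<close>)
  from tendsto_real_sqrt[OF this] show ?thesis
    by (simp add: tendsto_rabs_zero_iff)
qed

lemma H1_tendsto_0:
  assumes "u \<in> H1"
  shows "(u \<longlongrightarrow> 0) at_top" "(u \<longlongrightarrow> 0) at_bot"
proof -
  have d: "u \<in> Hdot1" "u \<in> L2" using assms by (auto simp: H1_def)
  note P = Hdot1_weak_deriv[OF d(1)]
  show "(u \<longlongrightarrow> 0) at_top" by (rule primitive_L2_tendsto_0_at_top[OF P(1) d(2) P(2)])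
  have "(\<lambda>x. - weak_deriv u (- x)) \<in> L2" using L2_reflect[OF P(2)] by (simp add: L2_def)
  then have "((\<lambda>x. u (- x)) \<longlongrightarrow> 0) at_top"
    by (rule primitive_L2_tendsto_0_at_top[OF is_primitive_reflect[OF P(1)] L2_reflect[OF d(2)]])
  then show "(u \<longlongrightarrow> 0) at_bot" by (simp add: filterlim_at_bot_mirror)
qed


section \<open>The pendulum equation on a half line\<close>

lemma sin_2_arctan: "sin (2 * arctan t) = 2 * t / (1 + t\<^sup>2)"
proof -
  have "1 + t\<^sup>2 > 0" by (simp add: add_pos_nonneg)
  then show ?thesis by (simp add: sin_double sin_arctan cos_arctan)
qed

text \<open>With t = c e^(sx) the derivative is 4st/(1 + t^2), which is 2s sin(2 arctan t). The
  signs s = 1 and s = -1 correspond to the two factors of the energy.\<close>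

lemma arctan_exp_has_derivative:
  "((\<lambda>x. 4 * arctan (c * exp (s * x))) has_real_derivative
     s * (2 * sin (4 * arctan (c * exp (s * x)) / 2))) (at x)"
proof -
  have "1 + (c * exp (s * x))\<^sup>2 > 0" by (simp add: add_pos_nonneg)
  then show ?thesis
    using sin_2_arctan[of "c * exp (s * x)"]
    by (auto intro!: derivative_eq_intros simp: field_simps)
qed

lemma first_order_imp_second_order:
  assumes "(y has_real_derivative s * (2 * sin (y x / 2))) (at x)" "s * s = 1"
  shows "((\<lambda>x. s * (2 * sin (y x / 2))) has_real_derivative sin (y x)) (at x)"
proof -
  have "((\<lambda>x. s * (2 * sin (y x / 2))) has_real_derivative
      s * (2 * (cos (y x / 2) * (s * (2 * sin (y x / 2)) / 2)))) (at x)"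
    by (auto intro!: derivative_eq_intros assms(1))
  moreover have "s * (2 * (cos (y x / 2) * (s * (2 * sin (y x / 2)) / 2)))
      = (s * s) * (2 * sin (y x / 2) * cos (y x / 2))" by simp
  then have "s * (2 * (cos (y x / 2) * (s * (2 * sin (y x / 2)) / 2))) = sin (y x)"
    using sin_double[of "y x / 2"] assms(2) by simp
  ultimately show ?thesis by (simp only:)
qed

text \<open>To the right of \<open>x0\<close> the function W e^(-Cx) is nonincreasing, to the left W
  e^(Cx) is nondecreasing, and nonnegativity leaves only 0. Both directions are needed since the
  known zero may lie anywhere on the half line.\<close>

lemma gronwall_zero:
  fixes W :: "real \<Rightarrow> real"
  assumes d: "\<And>x. x \<ge> 0 \<Longrightarrow> (W has_real_derivative W' x) (at x)"
    and b: "\<And>x. x \<ge> 0 \<Longrightarrow> \<bar>W' x\<bar> \<le> C * W x"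
    and nn: "\<And>x. W x \<ge> 0" and x0: "x0 \<ge> 0" "W x0 = 0" and x: "x \<ge> 0"
  shows "W x = 0"
proof (cases "x0 \<le> x")
  case True
  have "W x * exp (- (C * x)) \<le> W x0 * exp (- (C * x0))"
  proof (rule DERIV_nonpos_imp_nonincreasing[OF True])
    fix t assume "x0 \<le> t" "t \<le> x"
    then have t: "t \<ge> 0" using x0 by simp
    have "W' t - C * W t \<le> 0" using b[OF t] by linarith
    then have "(W' t - C * W t) * exp (- (C * t)) \<le> 0" by (simp add: mult_nonpos_nonneg)
    then show "\<exists>D. ((\<lambda>x. W x * exp (- (C * x))) has_real_derivative D) (at t) \<and> D \<le> 0"
      by (intro exI[of _ "(W' t - C * W t) * exp (- (C * t))"])
        (auto intro!: derivative_eq_intros d[OF t] simp: algebra_simps)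
  qed
  then show ?thesis using x0 nn[of x] by (simp add: mult_le_0_iff)
next
  case False
  then have "x \<le> x0" by simp
  then have "W x * exp (C * x) \<le> W x0 * exp (C * x0)"
  proof (rule DERIV_nonneg_imp_nondecreasing)
    fix t assume "x \<le> t" "t \<le> x0"
    then have t: "t \<ge> 0" using x by simp
    have "W' t + C * W t \<ge> 0" using b[OF t] by linarith
    then have "(W' t + C * W t) * exp (C * t) \<ge> 0" by simp
    then show "\<exists>D. ((\<lambda>x. W x * exp (C * x)) has_real_derivative D) (at t) \<and> 0 \<le> D"
      by (intro exI[of _ "(W' t + C * W t) * exp (C * t)"])
        (auto intro!: derivative_eq_intros d[OF t] simp: algebra_simps)
  qed
  then show ?thesis using x0 nn[of x] by (simp add: mult_le_0_iff)
qed

lemma abs_sin_diff_le: "\<bar>sin a - sin b\<bar> \<le> \<bar>a - b :: real\<bar>"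
proof -
  have "\<bar>sin a - sin b\<bar> = 2 * (\<bar>sin ((a - b) / 2)\<bar> * \<bar>cos ((a + b) / 2)\<bar>)"
    by (simp add: sin_diff_sin abs_mult)
  also have "\<dots> \<le> 2 * (\<bar>(a - b) / 2\<bar> * 1)"
    by (intro mult_left_mono mult_mono abs_sin_x_le_abs_x abs_cos_le_one) auto
  finally show ?thesis by simp
qed

text \<open>The explicit profile through the point (x0, y(x0)) solves the same equation, and
  Gronwall for the squared difference shows that it is y. The constant \<open>C = 2\<close> is the
  Lipschitz constant 1 of 2 sin(y/2), doubled by differentiating the square.\<close>

lemma first_order_solution:
  assumes d: "\<And>x. x \<ge> 0 \<Longrightarrow> (y has_real_derivative s * (2 * sin (y x / 2))) (at x)"
    and s: "\<bar>s\<bar> = 1" and x0: "x0 \<ge> 0" "\<bar>y x0\<bar> < 2 * pi"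
  obtains c where "\<And>x. x \<ge> 0 \<Longrightarrow> y x = 4 * arctan (c * exp (s * x))"
proof
  \<comment> \<open>The profile passes through y(x0) because |y(x0)/4| < pi/2, where arctan inverts
    tan.\<close>
  define c where "c = tan (y x0 / 4) * exp (- (s * x0))"
  define z where "z x = 4 * arctan (c * exp (s * x))" for x
  have dz: "(z has_real_derivative s * (2 * sin (z x / 2))) (at x)" for x
    unfolding z_def[abs_def] by (rule arctan_exp_has_derivative)
  have z0: "z x0 = y x0"
    using x0 by (simp add: z_def c_def mult.assoc flip: exp_add) (simp add: arctan_tan)
  fix x :: real assume x: "x \<ge> 0"
  have "(y x - z x)\<^sup>2 = 0"
  proof (rule gronwall_zero[where W = "\<lambda>x. (y x - z x)\<^sup>2" and C = 2 and ?x0.0 = x0])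
    fix t :: real assume t: "t \<ge> 0"
    show "((\<lambda>x. (y x - z x)\<^sup>2) has_real_derivative
        2 * (y t - z t) * (s * (2 * sin (y t / 2)) - s * (2 * sin (z t / 2)))) (at t)"
      by (auto intro!: derivative_eq_intros d[OF t] dz)
    have "\<bar>2 * (y t - z t) * (s * (2 * sin (y t / 2)) - s * (2 * sin (z t / 2)))\<bar>
        = 4 * (\<bar>y t - z t\<bar> * \<bar>sin (y t / 2) - sin (z t / 2)\<bar>)"
    proof -
      have "2 * (y t - z t) * (s * (2 * sin (y t / 2)) - s * (2 * sin (z t / 2)))
          = 4 * s * ((y t - z t) * (sin (y t / 2) - sin (z t / 2)))" by (simp add: algebra_simps)
      then show ?thesis using s by (simp only: abs_mult)
    qed
    also have "\<dots> \<le> 4 * (\<bar>y t - z t\<bar> * \<bar>y t / 2 - z t / 2\<bar>)"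
      by (intro mult_left_mono abs_sin_diff_le) auto
    also have "\<dots> = 2 * (\<bar>y t - z t\<bar> * \<bar>y t - z t\<bar>)"
      by (simp only: diff_divide_distrib[symmetric] abs_divide)
    also have "\<dots> = 2 * (y t - z t)\<^sup>2"
      by (simp only: power2_eq_square abs_mult_self_eq)
    finally show "\<bar>2 * (y t - z t) * (s * (2 * sin (y t / 2)) - s * (2 * sin (z t / 2)))\<bar>
        \<le> 2 * (y t - z t)\<^sup>2" .
  qed (use x0 z0 x in auto)
  then show "y x = 4 * arctan (c * exp (s * x))" by (simp add: z_def)
qed

text \<open>The energy is constant, but its value cannot be read off at infinity directly, because y
  tending to 0 says nothing about p. The mean value theorem gives points in (n, n+1) where p equals
  y(n+1) - y(n), which tends to 0; the energy is evaluated along these points.\<close>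

lemma pendulum_energy:
  assumes dy: "\<And>x. x \<ge> 0 \<Longrightarrow> (y has_real_derivative p x) (at x)"
    and dp: "\<And>x. x \<ge> 0 \<Longrightarrow> (p has_real_derivative sin (y x)) (at x)"
    and lim: "(y \<longlongrightarrow> 0) at_top" and x: "x \<ge> 0"
  shows "(p x)\<^sup>2 = (2 * sin (y x / 2))\<^sup>2"
proof -
  define E where "E x = (p x)\<^sup>2 - (2 * sin (y x / 2))\<^sup>2" for x
  have dE: "(E has_real_derivative 0) (at t)" if "t \<ge> 0" for t
    unfolding E_def[abs_def]
    using sin_double[of "y t / 2"]
    by (auto intro!: derivative_eq_intros dy[OF that] dp[OF that])
  have const: "E t = E 0" if "t \<ge> 0" for t
  proof (cases "t = 0")
    case False
    then have "0 < t" using that by simp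
    then show ?thesis
      by (rule DERIV_isconst_end)
        (auto intro!: continuous_at_imp_continuous_on DERIV_isCont[OF dE] dE)
  qed simp
  have "\<exists>\<xi>. real n < \<xi> \<and> \<xi> < real (Suc n) \<and> y (real (Suc n)) - y (real n) = p \<xi>" for n
    using MVT2[of "real n" "real (Suc n)" y p] dy by auto
  then obtain \<xi> where \<xi>: "\<And>n. real n < \<xi> n" "\<And>n. y (real (Suc n)) - y (real n) = p (\<xi> n)" by metis
  have \<xi>lim: "filterlim \<xi> at_top sequentially"
    by (rule filterlim_at_top_mono[OF filterlim_real_sequentially])
      (use \<xi>(1) in \<open>auto intro!: always_eventually less_imp_le\<close>)
  have l: "(\<lambda>n. y (real n)) \<longlonglongrightarrow> 0"
    by (rule filterlim_compose[OF lim filterlim_real_sequentially])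
  have "(\<lambda>n. (y (real (Suc n)) - y (real n))\<^sup>2 - (2 * sin (y (\<xi> n) * (1 / 2)))\<^sup>2) \<longlonglongrightarrow> (0 - 0)\<^sup>2 - (2 * sin (0 * (1 / 2)))\<^sup>2"
    by (intro tendsto_intros LIMSEQ_Suc[OF l] l filterlim_compose[OF lim \<xi>lim])
  moreover have "(y (real (Suc n)) - y (real n))\<^sup>2 - (2 * sin (y (\<xi> n) * (1 / 2)))\<^sup>2 = E 0" for n
  proof -
    have "\<xi> n \<ge> 0" using \<xi>(1)[of n] by (meson of_nat_0_le_iff less_imp_le order_trans)
    then show ?thesis using const[of "\<xi> n"] unfolding E_def \<xi>(2) by simp
  qed
  ultimately have "E 0 = 0" by (simp add: LIMSEQ_const_iff)
  then show ?thesis using const[OF x] by (simp add: E_def)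
qed

lemma pendulum_half_line:
  assumes dy: "\<And>x. x \<ge> 0 \<Longrightarrow> (y has_real_derivative p x) (at x)"
    and dp: "\<And>x. x \<ge> 0 \<Longrightarrow> (p has_real_derivative sin (y x)) (at x)"
    and lim: "(y \<longlongrightarrow> 0) at_top"
  obtains c where "\<And>x. x \<ge> 0 \<Longrightarrow> y x = 4 * arctan (c * exp (- x))" "p 0 = - 2 * sin (y 0 / 2)"
proof -
  \<comment> \<open>\<open>first_order_solution\<close> needs a point with |y| < 2 pi; the limit
    supplies one far out, whereas y(0) is not yet under control.\<close>
  obtain x0 where x0: "x0 \<ge> 0" "\<bar>y x0\<bar> < 2 * pi"
  proof -
    have "\<forall>\<^sub>F x in at_top. \<bar>y x\<bar> < 2 * pi"
      using tendstoD[OF lim, of "2 * pi"] by simp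
    then have "\<forall>\<^sub>F x in at_top. 0 \<le> x \<and> \<bar>y x\<bar> < 2 * pi"
      using eventually_ge_at_top[of 0] by eventually_elim simp
    then show ?thesis using that by (auto dest: eventually_happens'[rotated])
  qed
  define A where "A x = p x + 2 * sin (y x / 2)" for x
  have prod: "A x * (p x - 2 * sin (y x / 2)) = 0" if "x \<ge> 0" for x
    using pendulum_energy[OF dy dp lim that] by (simp add: A_def algebra_simps power2_eq_square)
  \<comment> \<open>A' = sin y + cos(y/2) p, and sin y = 2 sin(y/2) cos(y/2) lets cos(y/2) be
    factored out.\<close>
  have dA: "(A has_real_derivative cos (y x / 2) * A x) (at x)" if "x \<ge> 0" for x
    unfolding A_def[abs_def] using sin_double[of "y x / 2"]
    by (auto intro!: derivative_eq_intros dy[OF that] dp[OF that] simp: algebra_simps)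
  show ?thesis
  proof (cases "\<exists>x1\<ge>0. A x1 = 0")
    case True
    then obtain x1 where x1: "x1 \<ge> 0" "A x1 = 0" by blast
    have "(A x)\<^sup>2 = 0" if x: "x \<ge> 0" for x
    proof (rule gronwall_zero[where W = "\<lambda>x. (A x)\<^sup>2" and C = 2 and ?x0.0 = x1])
      fix t :: real assume t: "t \<ge> 0"
      show "((\<lambda>x. (A x)\<^sup>2) has_real_derivative 2 * A t * (cos (y t / 2) * A t)) (at t)"
        by (auto intro!: derivative_eq_intros dA[OF t])
      have "\<bar>cos (y t / 2)\<bar> * (A t)\<^sup>2 \<le> 1 * (A t)\<^sup>2" by (intro mult_right_mono) auto
      then show "\<bar>2 * A t * (cos (y t / 2) * A t)\<bar> \<le> 2 * (A t)\<^sup>2"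
        by (simp add: abs_mult power2_eq_square algebra_simps)
    qed (use x1 x in auto)
    then have p: "p x = (- 1) * (2 * sin (y x / 2))" if "x \<ge> 0" for x
      using that by (simp add: A_def eq_neg_iff_add_eq_0)
    have "(y has_real_derivative (- 1) * (2 * sin (y x / 2))) (at x)" if "x \<ge> 0" for x
      using dy[OF that] unfolding p[OF that] .
    then obtain c where "\<And>x. x \<ge> 0 \<Longrightarrow> y x = 4 * arctan (c * exp ((- 1) * x))"
      by (rule first_order_solution[where y = y, OF _ _ x0]) auto
    then show ?thesis using that[of c] p[of 0] by simp
  next
    case False
    then have p: "p x = 1 * (2 * sin (y x / 2))" if "x \<ge> 0" for x
      using prod[OF that] that by auto
    have "(y has_real_derivative 1 * (2 * sin (y x / 2))) (at x)" if "x \<ge> 0" for x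
      using dy[OF that] unfolding p[OF that] .
    then obtain c where c: "\<And>x. x \<ge> 0 \<Longrightarrow> y x = 4 * arctan (c * exp (1 * x))"
      by (rule first_order_solution[where y = y, OF _ _ x0]) auto
    \<comment> \<open>A growing profile with c \<noteq> 0 stays at distance at least 4 arctan |c|
      from 0, contradicting the limit. For c = 0 it is the zero solution, which also has the
      decaying form.\<close>
    have "c = 0"
    proof (rule ccontr)
      assume "c \<noteq> 0"
      then have pos: "4 * arctan \<bar>c\<bar> > 0" by simp
      have abs_arctan: "\<bar>arctan t\<bar> = arctan \<bar>t\<bar>" for t
        by (cases "t \<ge> 0") (auto simp: arctan_minus abs_if)
      have "4 * arctan \<bar>c\<bar> \<le> \<bar>y x\<bar>" if "x \<ge> 0" for x
      proof -
        have "\<bar>c\<bar> * 1 \<le> \<bar>c\<bar> * exp x" using that by (intro mult_left_mono) auto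
        then have "arctan \<bar>c\<bar> \<le> arctan \<bar>c * exp x\<bar>" by (simp add: abs_mult arctan_le_iff)
        then show ?thesis using c[OF that] by (simp add: abs_mult abs_arctan)
      qed
      moreover have "\<forall>\<^sub>F x in at_top. \<bar>y x\<bar> < 4 * arctan \<bar>c\<bar>"
        using tendstoD[OF lim pos] by simp
      then have "\<forall>\<^sub>F x in at_top. 0 \<le> x \<and> \<bar>y x\<bar> < 4 * arctan \<bar>c\<bar>"
        using eventually_ge_at_top[of 0] by eventually_elim simp
      then obtain x where "0 \<le> x" "\<bar>y x\<bar> < 4 * arctan \<bar>c\<bar>"
        by (auto dest: eventually_happens'[rotated])
      ultimately show False by force
    qed
    then show ?thesis using that[of 0] c p[of 0] by simp
  qed
qed


section \<open>Gluing at 0 and membership in \<open>L2\<close>\<close>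

lemma is_primitive_const: "is_primitive (\<lambda>x. c) (\<lambda>x. 0)"
  by (rule is_primitive_C1) auto

text \<open>Freezing \<open>g\<close> at its value at 0 keeps it continuous, so no jump at 0 has to
  be accounted for. Gluing two functions at 0 becomes adding their frozen difference to the left
  one.\<close>

lemma is_primitive_right_half:
  assumes P: "is_primitive g g'"
  shows "is_primitive (\<lambda>x. g (max x 0)) (\<lambda>x. indicator {0..} x * g' x)"
proof -
  have eq: "(\<lambda>x. indicator {s..t} x * (indicator {0..} x * g' x)) = (\<lambda>x. indicator {max s 0..t} x * g' x)" for s t :: real
    by (auto simp: indicator_def)
  show ?thesis
    unfolding is_primitive_def
  proof (intro conjI allI impI)
    show "continuous_on UNIV (\<lambda>x. g (max x 0))"
      by (intro continuous_on_compose2[OF is_primitiveD(1)[OF P]] continuous_intros) auto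
    show "locally_integrable (\<lambda>x. indicator {0..} x * g' x)"
      using locally_integrableD[OF is_primitiveD(2)[OF P]]
      by (simp add: locally_integrable_def set_integrable_def eq)
    fix a b :: real assume ab: "a \<le> b"
    show "(LINT x:{a..b}|lborel. indicator {0..} x * g' x) = g (max b 0) - g (max a 0)"
    proof (cases "b \<ge> 0")
      case True
      then show ?thesis using is_primitiveD(3)[OF P, of "max a 0" b] ab
        by (simp add: set_lebesgue_integral_def eq)
    next
      case False
      then show ?thesis using ab by (simp add: set_lebesgue_integral_def eq)
    qed
  qed
qed

lemma continuous_antiderivative:
  fixes f :: "real \<Rightarrow> real"
  assumes "continuous_on UNIV f"
  obtains F where "\<And>x. (F has_real_derivative f x) (at x)"
  using einterval_antiderivative[of "-\<infinity>" \<infinity> f] assms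
  by (auto simp: continuous_on_eq_continuous_at has_real_derivative_iff_has_vector_derivative)

lemma L2_cmult: "f \<in> L2 \<Longrightarrow> (\<lambda>x. c * f x) \<in> L2"
  by (auto simp: L2_def power_mult_distrib)

lemma L2_diff:
  assumes "f \<in> L2" "g \<in> L2"
  shows "(\<lambda>x. f x - g x) \<in> L2"
proof -
  have "integrable lborel (\<lambda>x. (f x)\<^sup>2 + (g x)\<^sup>2 - 2 * (f x * g x))"
    using assms L2_mult_integrable[OF assms] by (simp add: L2_def)
  then have "integrable lborel (\<lambda>x. (f x - g x)\<^sup>2)"
    by (simp add: power2_diff mult.assoc)
  moreover have "(\<lambda>x. f x - g x) \<in> borel_measurable borel"
    using assms by (intro borel_measurable_diff) (auto simp: L2_def)
  ultimately show ?thesis by (simp add: L2_def)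
qed

lemma L2_indicator_Icc: "(indicator {a..b} :: real \<Rightarrow> real) \<in> L2"
proof -
  have "(\<lambda>x. (indicator {a..b} x :: real)\<^sup>2) = indicator {a..b}"
    by (auto simp: indicator_def)
  then show ?thesis
    by (auto simp: L2_def emeasure_lborel_Icc_eq intro!: integrable_real_indicator)
qed

lemma L2_bound:
  assumes "g \<in> L2" "f \<in> borel_measurable borel" "\<And>x. \<bar>f x\<bar> \<le> g x"
  shows "f \<in> L2"
proof -
  have "integrable lborel (\<lambda>x. (f x)\<^sup>2)"
  proof (rule Bochner_Integration.integrable_bound)
    show "integrable lborel (\<lambda>x. (g x)\<^sup>2)" using assms by (simp add: L2_def)
    show "(\<lambda>x. (f x)\<^sup>2) \<in> borel_measurable lborel" using assms(2) by simp
    show "AE x in lborel. norm ((f x)\<^sup>2) \<le> norm ((g x)\<^sup>2)"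
    proof (rule AE_I2)
      fix x
      have "\<bar>f x\<bar>\<^sup>2 \<le> (g x)\<^sup>2" by (intro power_mono assms(3)) simp
      then show "norm ((f x)\<^sup>2) \<le> norm ((g x)\<^sup>2)" by simp
    qed
  qed
  then show ?thesis using assms(2) by (simp add: L2_def)
qed

lemma exp_minus_abs_L2: "(\<lambda>x. C * exp (- \<bar>x\<bar>)) \<in> L2"
proof -
  have "(\<lambda>x::real. exp (- 2 * x)) absolutely_integrable_on {0..}"
    by (rule nonnegative_absolutely_integrable_1) (use integrable_on_exp_minus_to_infinity[of 2 0] in auto)
  moreover have "(\<lambda>x::real. indicator {0..} x *\<^sub>R exp (- 2 * x)) \<in> borel_measurable lborel" by measurable
  ultimately have "set_integrable lborel {0..} (\<lambda>x::real. exp (- 2 * x))"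
    unfolding set_integrable_def by (simp only: integrable_completion)
  then have i: "integrable lborel (\<lambda>x::real. indicator {0..} x * exp (- 2 * x))"
    by (simp add: set_integrable_def)
  have "integrable lborel (\<lambda>x::real. indicator {0..} (0 + (- 1) * x) * exp (- 2 * (0 + (- 1) * x)))"
    by (rule lborel_integrable_real_affine[OF i]) simp
  then have "integrable lborel (\<lambda>x::real. indicator {0..} x * exp (- 2 * x)
      + indicator {0..} (0 + (- 1) * x) * exp (- 2 * (0 + (- 1) * x)))"
    using i by (rule Bochner_Integration.integrable_add[rotated])
  then have "integrable lborel (\<lambda>x::real. (exp (- \<bar>x\<bar>))\<^sup>2)"
  proof (rule Bochner_Integration.integrable_bound)
    show "AE x::real in lborel. norm ((exp (- \<bar>x\<bar>))\<^sup>2) \<le> norm (indicator {0..} x * exp (- 2 * x)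
      + indicator {0..} (0 + (- 1) * x) * exp (- 2 * (0 + (- 1) * x)))"
    proof (rule AE_I2)
      fix x :: real
      have "(exp (- \<bar>x\<bar>))\<^sup>2 = exp (- 2 * \<bar>x\<bar>)" by (simp flip: exp_double)
      then show "norm ((exp (- \<bar>x\<bar>))\<^sup>2) \<le> norm (indicator {0..} x * exp (- 2 * x)
          + indicator {0..} (0 + (- 1) * x) * exp (- 2 * (0 + (- 1) * x)))"
        by (cases "x \<ge> 0") (auto simp: indicator_def)
    qed
  qed measurable
  then have "(\<lambda>x. exp (- \<bar>x\<bar>)) \<in> L2" by (simp add: L2_def)
  then show ?thesis by (rule L2_cmult)
qed

section \<open>From the weak equation to the pendulum equation on each half line\<close>

text \<open>The step function is the derivative of the hat of height 1 with nodes \<open>a\<close>,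
  \<open>b\<close>, \<open>c\<close>; that both indicators contain \<open>b\<close> is harmless
  under the integral.\<close>

lemma integral_hat_derivative:
  assumes P: "is_primitive g g'" and abc: "a < b" "b < c"
  shows "(\<integral>x. g' x * (1 / (b - a) * indicator {a..b} x - 1 / (c - b) * indicator {b..c} x) \<partial>lborel)
    = (g b - g a) / (b - a) - (g c - g b) / (c - b)"
proof -
  have i: "integrable lborel (\<lambda>x. indicator {s..t} x * g' x)" for s t
    using locally_integrableD[OF is_primitiveD(2)[OF P], of s t] by (simp add: set_integrable_def)
  have "(\<integral>x. g' x * (1 / (b - a) * indicator {a..b} x - 1 / (c - b) * indicator {b..c} x) \<partial>lborel)
     = (\<integral>x. 1 / (b - a) * (indicator {a..b} x * g' x) - 1 / (c - b) * (indicator {b..c} x * g' x) \<partial>lborel)"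
    by (intro Bochner_Integration.integral_cong refl) (simp add: algebra_simps)
  also have "\<dots> = 1 / (b - a) * (\<integral>x. indicator {a..b} x * g' x \<partial>lborel)
      - 1 / (c - b) * (\<integral>x. indicator {b..c} x * g' x \<partial>lborel)"
    using i by (subst Bochner_Integration.integral_diff) auto
  also have "\<dots> = (g b - g a) / (b - a) - (g c - g b) / (c - b)"
    using is_primitiveD(3)[OF P, of a b] is_primitiveD(3)[OF P, of b c] abc
    by (simp add: set_lebesgue_integral_def)
  finally show ?thesis .
qed

text \<open>Let S(g) be the slope of g over [a, b] minus its slope over [b, c]. Tested with the hat,
  the first term of the equation is S(u), the second is -S(F2) after integration by parts, and the
  value of the hat at 0 is -S(g) for g(x) = max x 0. The equation thus reads S(w) = 0.\<close>

lemma weak_equation_slopes: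
  assumes "solves q u" and F1: "\<And>x. (F1 has_real_derivative sin (u x)) (at x)"
    and F2: "\<And>x. (F2 has_real_derivative F1 x) (at x)" and abc: "a < b" "b < c"
    and w: "w = (\<lambda>x. u x - F2 x - q * sin (u 0) * max x 0)"
  shows "(w b - w a) / (b - a) = (w c - w b) / (c - b)"
proof -
  have u: "u \<in> Hdot1" using assms(1) by (simp add: solves_def H1sin_def)
  note Pu = Hdot1_weak_deriv[OF u]
  have cu: "continuous_on UNIV (\<lambda>x. sin (u x))"
    by (intro continuous_intros is_primitiveD(1)[OF Pu(1)])
  have P1: "is_primitive F1 (\<lambda>x. sin (u x))" by (rule is_primitive_C1[OF F1 cu])
  have P2: "is_primitive F2 F1" by (rule is_primitive_C1[OF F2 is_primitiveD(1)[OF P1]])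
  define k where "k = q * sin (u 0)"
  define st where "st x = 1 / (b - a) * indicator {a..b} x - 1 / (c - b) * indicator {b..c} x" for x :: real
  \<comment> \<open>Each normalized clamp rises by 1, the first over [a, b] and the second over
    [b, c]; the constant makes the value to the left of \<open>a\<close> equal 0.\<close>
  define hat where "hat x = 1 / (b - a) * max a (min x b) - 1 / (c - b) * max b (min x c)
      - (a / (b - a) - b / (c - b))" for x
  have Ph: "is_primitive hat st"
  proof -
    have "is_primitive hat (\<lambda>x. 1 / (b - a) * indicator {a..b} x - 1 / (c - b) * indicator {b..c} x - 0)"
      unfolding hat_def using abc
      by (intro is_primitive_diff is_primitive_cmult is_primitive_const is_primitive_clamp) auto
    then show ?thesis by (simp add: st_def[abs_def])
  qed
  have h0: "hat x = 0" if "x \<notin> {a<..<c}" for x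
  proof (cases "x \<le> a")
    case True then show ?thesis using abc by (simp add: hat_def)
  next
    case False
    then have "x \<ge> c" using that by auto
    then have "hat x = (b - a) / (b - a) - (c - b) / (c - b)"
      using abc by (simp only: hat_def diff_divide_distrib) simp
    then show ?thesis using abc by simp
  qed
  have s0: "st x = 0" if "x \<notin> {a..c}" for x
    using that abc by (auto simp: st_def)
  have stL2: "st \<in> L2"
    unfolding st_def by (intro L2_diff L2_cmult L2_indicator_Icc)
  have hL2: "hat \<in> L2"
    unfolding L2_def mem_Collect_eq
  proof
    show "hat \<in> borel_measurable lborel"
      using is_primitiveD(1)[OF Ph] by (simp add: borel_measurable_continuous_onI)
    show "integrable lborel (\<lambda>x. (hat x)\<^sup>2)"
      by (rule integrable_compact_support[of a c])
        (use h0 in \<open>auto intro!: continuous_intros continuous_on_subset[OF is_primitiveD(1)[OF Ph]]\<close>)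
  qed
  have hat: "hat \<in> H1" "AE x in lborel. weak_deriv hat x = st x"
    using Hdot1I[OF Ph stL2] hL2 by (auto simp: H1_def)
  have "(\<integral>x. weak_deriv u x * weak_deriv hat x \<partial>lborel) = (\<integral>x. weak_deriv u x * st x \<partial>lborel)"
  proof (rule integral_cong_AE)
    have [measurable]: "weak_deriv u \<in> borel_measurable lborel" "st \<in> borel_measurable lborel"
      "weak_deriv hat \<in> borel_measurable lborel"
      using Pu(2) stL2 Hdot1_weak_deriv(2)[of hat] hat(1) by (auto simp: L2_def H1_def)
    show "(\<lambda>x. weak_deriv u x * weak_deriv hat x) \<in> borel_measurable lborel"
      "(\<lambda>x. weak_deriv u x * st x) \<in> borel_measurable lborel" by measurable
    show "AE x in lborel. weak_deriv u x * weak_deriv hat x = weak_deriv u x * st x"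
      using hat(2) by eventually_elim simp
  qed
  also have "\<dots> = (u b - u a) / (b - a) - (u c - u b) / (c - b)"
    unfolding st_def by (rule integral_hat_derivative[OF Pu(1) abc])
  moreover have "(\<integral>x. sin (u x) * hat x \<partial>lborel) = - ((F2 b - F2 a) / (b - a) - (F2 c - F2 b) / (c - b))"
    using integral_by_parts_compact_support[OF P1 Ph h0 s0] integral_hat_derivative[OF P2 abc]
    by (simp add: st_def)
  moreover have "hat 0 = - ((max b 0 - max a 0) / (b - a) - (max c 0 - max b 0) / (c - b))"
  proof -
    \<comment> \<open>Both sides are the length of the part of the interval to the right of 0, which
      ties the value of the hat at 0 to increments of max x 0.\<close>
    have "max b 0 - max a 0 = b - max a (min 0 b)" "max c 0 - max b 0 = c - max b (min 0 c)"
      using abc by (auto simp: max_def min_def)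
    then have "(max b 0 - max a 0) / (b - a) - (max c 0 - max b 0) / (c - b)
       = (b - max a (min 0 b)) / (b - a) - (c - max b (min 0 c)) / (c - b)" by simp
    also have "\<dots> = (b - a) / (b - a) - (c - b) / (c - b) - hat 0"
      unfolding hat_def diff_divide_distrib by simp
    finally have "(max b 0 - max a 0) / (b - a) - (max c 0 - max b 0) / (c - b)
       = (b - a) / (b - a) - (c - b) / (c - b) - hat 0" .
    then show ?thesis using abc by simp
  qed
  moreover have "(\<integral>x. weak_deriv u x * weak_deriv hat x \<partial>lborel) + (\<integral>x. sin (u x) * hat x \<partial>lborel) + k * hat 0 = 0"
    using assms(1) hat(1) by (simp add: solves_def k_def)
  ultimately have "((u b - u a) / (b - a) - (u c - u b) / (c - b))
      - ((F2 b - F2 a) / (b - a) - (F2 c - F2 b) / (c - b))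
      - k * ((max b 0 - max a 0) / (b - a) - (max c 0 - max b 0) / (c - b)) = 0"
    by (simp add: right_diff_distrib)
  then show ?thesis
    unfolding w k_def[symmetric] by (simp add: diff_divide_distrib right_diff_distrib)
qed

lemma equal_slopes_imp_affine:
  fixes w :: "real \<Rightarrow> real"
  assumes s: "\<And>a b c. a < b \<Longrightarrow> b < c \<Longrightarrow> (w b - w a) / (b - a) = (w c - w b) / (c - b)"
  shows "w x = w 0 + (w 1 - w 0) * x"
proof -
  consider "x < 0" | "x = 0" | "0 < x" "x < 1" | "x = 1" | "x > 1" by linarith
  then show ?thesis
  proof cases
    case 1
    then show ?thesis using s[of x 0 1] by (simp add: field_simps)
  next
    case 3
    then have "(w x - w 0) * (1 - x) = (w 1 - w x) * x" using s[of 0 x 1] by (simp add: field_simps)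
    then show ?thesis by (simp add: algebra_simps)
  next
    case 5
    then have "(w 1 - w 0) * (x - 1) = w x - w 1" using s[of 0 1 x] by (simp add: field_simps)
    then show ?thesis by (simp add: algebra_simps)
  qed auto
qed

text \<open>Each half of u is continued past 0 by \<open>F2\<close> plus an affine function, so
  \<open>pp 0\<close> and \<open>pm 0\<close> are two-sided derivatives of the continuations and
  their difference is the jump of u'. The second derivative is stated as sin(u), since a
  continuation is known to solve the pendulum equation only on its own half line.\<close>

lemma solves_imp_pieces:
  assumes "solves q u"
  obtains yp pp ym pm where
    "\<And>x. (yp has_real_derivative pp x) (at x)" "\<And>x. (pp has_real_derivative sin (u x)) (at x)"
    "\<And>x. x \<ge> 0 \<Longrightarrow> yp x = u x"
    "\<And>x. (ym has_real_derivative pm x) (at x)" "\<And>x. (pm has_real_derivative sin (u x)) (at x)"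
    "\<And>x. x \<le> 0 \<Longrightarrow> ym x = u x"
    "pp 0 - pm 0 = q * sin (u 0)"
proof -
  have u: "continuous_on UNIV u" using assms by (simp add: solves_def H1sin_def Hdot1_def)
  obtain F1 where F1: "\<And>x. (F1 has_real_derivative sin (u x)) (at x)"
    using continuous_antiderivative[of "\<lambda>x. sin (u x)"] u by (auto intro: continuous_intros)
  then have "continuous_on UNIV F1"
    by (meson DERIV_isCont continuous_at_imp_continuous_on)
  then obtain F2 where F2: "\<And>x. (F2 has_real_derivative F1 x) (at x)"
    using continuous_antiderivative by blast
  define k where "k = q * sin (u 0)"
  define w where "w = (\<lambda>x. u x - F2 x - k * max x 0)"
  define d where "d = w 1 - w 0"
  have aff: "w x = w 0 + d * x" for x
    unfolding d_def
    by (rule equal_slopes_imp_affine[OF weak_equation_slopes[OF assms F1 F2]]) (auto simp: w_def k_def)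
  show ?thesis
  proof (rule that[of "\<lambda>x. F2 x + k * x + (w 0 + d * x)" "\<lambda>x. F1 x + k + d"
        "\<lambda>x. F2 x + (w 0 + d * x)" "\<lambda>x. F1 x + d"])
    show "F2 x + k * x + (w 0 + d * x) = u x" if "x \<ge> 0" for x
      using that unfolding aff[symmetric] by (simp add: w_def)
    show "F2 x + (w 0 + d * x) = u x" if "x \<le> 0" for x
      using that unfolding aff[symmetric] by (simp add: w_def)
  qed (auto intro!: derivative_eq_intros F1 F2 simp: k_def)
qed

section \<open>From pendulum pieces back to the weak equation\<close>

lemma integral_tendsto_symmetric:
  fixes f :: "real \<Rightarrow> real"
  assumes f: "integrable lborel f"
  shows "(\<lambda>n. LINT x:{- real n..real n}|lborel. f x) \<longlonglongrightarrow> (\<integral>x. f x \<partial>lborel)"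
  unfolding set_lebesgue_integral_def
proof (rule integral_dominated_convergence)
  have [measurable]: "f \<in> borel_measurable borel" using f by auto
  show "f \<in> borel_measurable lborel" "(\<lambda>x. indicator {- real n..real n} x *\<^sub>R f x) \<in> borel_measurable lborel" for n
    by measurable
  show "integrable lborel (\<lambda>x. \<bar>f x\<bar>)" using f by simp
  show "AE x in lborel. (\<lambda>n. indicator {- real n..real n} x *\<^sub>R f x) \<longlonglongrightarrow> f x"
  proof (rule AE_I2)
    fix x :: real
    obtain N where "\<bar>x\<bar> \<le> real N" using real_arch_simple by blast
    then have "\<forall>\<^sub>F n in sequentially. indicator {- real n..real n} x *\<^sub>R f x = f x"
      by (intro eventually_sequentiallyI[of N]) (auto simp: indicator_def abs_le_iff)
    then show "(\<lambda>n. indicator {- real n..real n} x *\<^sub>R f x) \<longlonglongrightarrow> f x"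
      by (rule tendsto_eventually)
  qed
  show "AE x in lborel. norm (indicator {- real n..real n} x *\<^sub>R f x) \<le> \<bar>f x\<bar>" for n
    by (auto intro!: AE_I2 simp: indicator_def)
qed

lemma glued_pieces_solve:
  assumes yp: "\<And>x. (yp has_real_derivative pp x) (at x)" "\<And>x. (pp has_real_derivative sin (yp x)) (at x)"
    and ym: "\<And>x. (ym has_real_derivative pm x) (at x)" "\<And>x. (pm has_real_derivative sin (ym x)) (at x)"
    and match: "yp 0 = ym 0" and jump: "pp 0 - pm 0 = q * sin (yp 0)"
    and bp: "\<And>x. x \<ge> 0 \<Longrightarrow> \<bar>pp x\<bar> \<le> C * exp (- x) \<and> \<bar>sin (yp x / 2)\<bar> \<le> C * exp (- x)"
    and bm: "\<And>x. x \<le> 0 \<Longrightarrow> \<bar>pm x\<bar> \<le> C * exp x \<and> \<bar>sin (ym x / 2)\<bar> \<le> C * exp x"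
    and u: "\<And>x. x \<ge> 0 \<Longrightarrow> u x = yp x" "\<And>x. x \<le> 0 \<Longrightarrow> u x = ym x"
  shows "solves q u"
proof -
  define k where "k = pp 0 - pm 0"
  define v where "v x = (if x \<ge> 0 then pp x else pm x)" for x
  note cont = DERIV_isCont[OF yp(1)] DERIV_isCont[OF yp(2)] DERIV_isCont[OF ym(1)] DERIV_isCont[OF ym(2)]
  have c: "continuous_on UNIV yp" "continuous_on UNIV pp" "continuous_on UNIV ym" "continuous_on UNIV pm"
    using cont by (auto intro!: continuous_at_imp_continuous_on)
  have Pu: "is_primitive u v"
  proof -
    have "is_primitive (\<lambda>x. yp x - ym x) (\<lambda>x. pp x - pm x)"
      by (intro is_primitive_diff is_primitive_C1 yp ym c)
    then have "is_primitive (\<lambda>x. ym x + (yp (max x 0) - ym (max x 0))) (\<lambda>x. pm x + indicator {0..} x * (pp x - pm x))"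
      by (rule is_primitive_add[OF is_primitive_C1[OF ym(1) c(4)] is_primitive_right_half])
    moreover have "(\<lambda>x. ym x + (yp (max x 0) - ym (max x 0))) = u"
      using match u by (auto simp: max_def)
    moreover have "(\<lambda>x. pm x + indicator {0..} x * (pp x - pm x)) = v"
      by (auto simp: v_def)
    ultimately show ?thesis by simp
  qed
  \<comment> \<open>Removing the jump makes the derivative of \<open>u\<close> itself a primitive; the removed part is paired
    with \<open>\<phi>\<close> through \<open>\<phi> (max x 0)\<close>.\<close>
  have Pv: "is_primitive (\<lambda>x. v x - k * indicator {0..} x) (\<lambda>x. sin (u x))"
  proof -
    have "is_primitive (\<lambda>x. pp x - pm x) (\<lambda>x. sin (yp x) - sin (ym x))"
      by (intro is_primitive_diff is_primitive_C1 yp ym c continuous_intros)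
    moreover have "is_primitive pm (\<lambda>x. sin (ym x))"
      by (intro is_primitive_C1 ym c continuous_intros)
    ultimately have "is_primitive (\<lambda>x. pm x + (pp (max x 0) - pm (max x 0)) - k)
        (\<lambda>x. sin (ym x) + indicator {0..} x * (sin (yp x) - sin (ym x)) - 0)"
      by (intro is_primitive_add is_primitive_diff[OF _ is_primitive_const]
          is_primitive_right_half[where g = "\<lambda>x. pp x - pm x"])
    moreover have "(\<lambda>x. pm x + (pp (max x 0) - pm (max x 0)) - k) = (\<lambda>x. v x - k * indicator {0..} x)"
      by (auto simp: v_def k_def max_def indicator_def)
    moreover have "(\<lambda>x. sin (ym x) + indicator {0..} x * (sin (yp x) - sin (ym x)) - 0) = (\<lambda>x. sin (u x))"
      using u by (auto simp: indicator_def)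
    ultimately show ?thesis by simp
  qed
  have bv: "\<bar>v x\<bar> \<le> C * exp (- \<bar>x\<bar>)" for x using bp[of x] bm[of x] by (auto simp: v_def)
  have bs: "\<bar>sin (u x / 2)\<bar> \<le> C * exp (- \<bar>x\<bar>)" for x using bp[of x] bm[of x] u[of x] by (cases "x \<ge> 0") auto
  have [measurable]: "u \<in> borel_measurable borel" "v \<in> borel_measurable borel"
    using locally_integrable_measurable[OF is_primitiveD(2)[OF Pu]] is_primitiveD(1)[OF Pu]
    by (auto intro: borel_measurable_continuous_onI)
  have vL2: "v \<in> L2" by (rule L2_bound[OF exp_minus_abs_L2 _ bv]) measurable
  have sL2: "(\<lambda>x. sin (u x / 2)) \<in> L2" by (rule L2_bound[OF exp_minus_abs_L2 _ bs]) measurable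
  have sinL2: "(\<lambda>x. sin (u x)) \<in> L2"
  proof (rule L2_bound[OF exp_minus_abs_L2[of "2 * C"]])
    fix x
    have "\<bar>sin (u x)\<bar> = 2 * (\<bar>sin (u x / 2)\<bar> * \<bar>cos (u x / 2)\<bar>)"
      using sin_double[of "u x / 2"] by (simp add: abs_mult)
    also have "\<dots> \<le> 2 * (\<bar>sin (u x / 2)\<bar> * 1)" by (intro mult_left_mono) auto
    finally show "\<bar>sin (u x)\<bar> \<le> 2 * C * exp (- \<bar>x\<bar>)" using bs[of x] by simp
  qed measurable
  note u1 = Hdot1I[OF Pu vL2]
  show ?thesis
    unfolding solves_def
  proof (intro conjI ballI)
    show "u \<in> H1sin" using u1(1) sL2 by (simp add: H1sin_def)
    fix \<phi> assume \<phi>: "\<phi> \<in> H1"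
    then have \<phi>d: "\<phi> \<in> Hdot1" "\<phi> \<in> L2" by (auto simp: H1_def)
    define z where "z = weak_deriv \<phi>"
    have P\<phi>: "is_primitive \<phi> z" and zL2: "z \<in> L2" unfolding z_def by (rule Hdot1_weak_deriv[OF \<phi>d(1)])+
    have "(\<integral>x. weak_deriv u x * z x \<partial>lborel) = (\<integral>x. v x * z x \<partial>lborel)"
    proof (rule integral_cong_AE)
      have [measurable]: "weak_deriv u \<in> borel_measurable lborel" "z \<in> borel_measurable lborel"
        using Hdot1_weak_deriv(2)[OF u1(1)] zL2 by (auto simp: L2_def)
      show "(\<lambda>x. weak_deriv u x * z x) \<in> borel_measurable lborel"
        "(\<lambda>x. v x * z x) \<in> borel_measurable lborel" by measurable
      show "AE x in lborel. weak_deriv u x * z x = v x * z x"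
        using u1(2) by eventually_elim simp
    qed
    moreover have "(\<integral>x. v x * z x + sin (u x) * \<phi> x \<partial>lborel) = - k * \<phi> 0"
    proof -
      have i: "integrable lborel (\<lambda>x. v x * z x + sin (u x) * \<phi> x)"
        using L2_mult_integrable[OF vL2 zL2] L2_mult_integrable[OF sinL2 \<phi>d(2)] by simp
      have "is_primitive (\<lambda>x. (v x - k * indicator {0..} x) * \<phi> x + k * \<phi> (max x 0))
          (\<lambda>x. ((v x - k * indicator {0..} x) * z x + \<phi> x * sin (u x)) + k * (indicator {0..} x * z x))"
        by (intro is_primitive_add is_primitive_mult is_primitive_cmult is_primitive_right_half Pv P\<phi>)
      moreover have "(\<lambda>x. ((v x - k * indicator {0..} x) * z x + \<phi> x * sin (u x)) + k * (indicator {0..} x * z x))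
          = (\<lambda>x. v x * z x + sin (u x) * \<phi> x)"
        by (auto simp: algebra_simps)
      ultimately have P: "is_primitive (\<lambda>x. (v x - k * indicator {0..} x) * \<phi> x + k * \<phi> (max x 0))
          (\<lambda>x. v x * z x + sin (u x) * \<phi> x)" by simp
      \<comment> \<open>n > 0 keeps the left end point out of the indicator of [0,
        \<infinity>).\<close>
      have eq: "(LINT x:{- real n..real n}|lborel. v x * z x + sin (u x) * \<phi> x)
          = v (real n) * \<phi> (real n) - v (- real n) * \<phi> (- real n) - k * \<phi> 0" if "n > 0" for n
        using is_primitiveD(3)[OF P, of "- real n" "real n"] that
        by (simp add: algebra_simps)
      have vb: "\<bar>v x\<bar> \<le> \<bar>C\<bar>" for x
      proof -
        have "C * exp (- \<bar>x\<bar>) \<le> \<bar>C\<bar> * 1" by (intro mult_mono) auto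
        then show ?thesis using bv[of x] by simp
      qed
      have v0: "(\<lambda>n. v (X n) * \<phi> (X n)) \<longlonglongrightarrow> 0" if "(\<lambda>n. \<phi> (X n)) \<longlonglongrightarrow> 0" for X :: "nat \<Rightarrow> real"
      proof (rule Lim_null_comparison)
        show "\<forall>\<^sub>F n in sequentially. norm (v (X n) * \<phi> (X n)) \<le> \<bar>C\<bar> * \<bar>\<phi> (X n)\<bar>"
          using vb by (auto simp: abs_mult intro!: always_eventually mult_right_mono)
        show "(\<lambda>n. \<bar>C\<bar> * \<bar>\<phi> (X n)\<bar>) \<longlonglongrightarrow> 0"
          using that by (intro tendsto_mult_right_zero) (simp add: tendsto_rabs_zero_iff)
      qed
      have "(\<lambda>n. v (real n) * \<phi> (real n) - v (- real n) * \<phi> (- real n) - k * \<phi> 0) \<longlonglongrightarrow> 0 - 0 - k * \<phi> 0"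
        by (intro tendsto_diff v0 tendsto_const filterlim_compose[OF H1_tendsto_0(1)[OF \<phi>]]
            filterlim_compose[OF H1_tendsto_0(2)[OF \<phi>]] filterlim_real_sequentially
            filterlim_compose[OF filterlim_uminus_at_bot_at_top])
      then have "(\<lambda>n. LINT x:{- real n..real n}|lborel. v x * z x + sin (u x) * \<phi> x) \<longlonglongrightarrow> 0 - 0 - k * \<phi> 0"
        by (rule Lim_transform_eventually)
          (use eq in \<open>auto intro!: eventually_mono[OF eventually_gt_at_top[of 0]]\<close>)
      then show ?thesis using LIMSEQ_unique[OF _ integral_tendsto_symmetric[OF i]] by simp
    qed
    ultimately show "(\<integral>x. weak_deriv u x * weak_deriv \<phi> x \<partial>lborel) + (\<integral>x. sin (u x) * \<phi> x \<partial>lborel)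
        + q * sin (u 0) * \<phi> 0 = 0"
      using L2_mult_integrable[OF vL2 zL2] L2_mult_integrable[OF sinL2 \<phi>d(2)] jump u(1)[of 0]
      by (simp add: z_def k_def)
  qed
qed


section \<open>The explicit profiles\<close>

lemma cos_2_arctan: "cos (2 * arctan t) = (1 - t\<^sup>2) / (1 + t\<^sup>2)"
proof -
  have "1 + t\<^sup>2 > 0" by (simp add: add_pos_nonneg)
  then show ?thesis
    by (simp add: cos_double cos_arctan sin_arctan power_divide diff_divide_distrib)
qed

text \<open>The denominator of 2|t|/(1 + t^2) dominates both 1 and t^2. The first bound gives decay
  where the argument of arctan tends to 0, the second where it is unbounded, as on the right half of
  the kink.\<close>

lemma abs_sin_2_arctan_le:
  "\<bar>sin (2 * arctan t)\<bar> \<le> 2 * \<bar>t\<bar>"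
  "t \<noteq> 0 \<Longrightarrow> \<bar>sin (2 * arctan t)\<bar> \<le> 2 / \<bar>t\<bar>"
proof -
  have p: "1 + t\<^sup>2 > 0" by (simp add: add_pos_nonneg)
  have e: "\<bar>sin (2 * arctan t)\<bar> = 2 * \<bar>t\<bar> / (1 + t\<^sup>2)"
    unfolding sin_2_arctan using p by (simp add: abs_mult)
  have "2 * \<bar>t\<bar> / (1 + t\<^sup>2) \<le> 2 * \<bar>t\<bar> / 1"
    by (intro divide_left_mono) (use p in auto)
  then show "\<bar>sin (2 * arctan t)\<bar> \<le> 2 * \<bar>t\<bar>" using e by simp
  assume "t \<noteq> 0"
  then show "\<bar>sin (2 * arctan t)\<bar> \<le> 2 / \<bar>t\<bar>"
    using p unfolding e by (simp add: field_simps power2_eq_square)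
qed

text \<open>With \<theta> = 2 arctan c the value at 0 is 2 \<theta> and the one-sided slopes are -2
  sin \<theta> on the right and 2 sin \<theta> on the left, so the jump condition is q sin(2
  \<theta>) = -4 sin \<theta>. It follows from q cos \<theta> = -2, which is c^2 (q - 2) = q + 2
  rewritten by the half-angle formula.\<close>

lemma Q_solves:
  assumes "\<bar>q\<bar> > 2"
  shows "solves q (Q q)"
proof -
  define c where "c = sqrt ((q + 2) / (q - 2))"
  have "(q + 2) / (q - 2) \<ge> 0" using assms by (cases "q > 0") (auto simp: zero_le_divide_iff)
  then have c2: "c\<^sup>2 = (q + 2) / (q - 2)" and c0: "c \<ge> 0" by (simp_all add: c_def)
  define y where "y s x = 4 * arctan (c * exp (s * x))" for s x :: real
  have y: "(y s has_real_derivative s * (2 * sin (y s x / 2))) (at x)" for s x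
    unfolding y_def[abs_def] by (rule arctan_exp_has_derivative)
  have half: "y s x / 2 = 2 * arctan (c * exp (s * x))" for s x by (simp add: y_def)
  show ?thesis
  \<comment> \<open>The constant \<open>4 * c\<close> comes from |2 sin(2 arctan t)| \<le> 4 |t|
    with t = c e^(-|x|).\<close>
  proof (rule glued_pieces_solve[where yp = "y (- 1)" and ym = "y 1" and C = "4 * c"
        and pp = "\<lambda>x. (- 1) * (2 * sin (y (- 1) x / 2))" and pm = "\<lambda>x. 1 * (2 * sin (y 1 x / 2))"])
    show "y (- 1) 0 = y 1 0" by (simp add: y_def)
    have p: "1 + c\<^sup>2 > 0" by (simp add: add_pos_nonneg)
    have "c\<^sup>2 * (q - 2) = q + 2" using assms c2 by simp
    then have "q * (1 - c\<^sup>2) = - 2 * (1 + c\<^sup>2)" by (simp add: algebra_simps)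
    then have "q * cos (2 * arctan c) = - 2 * (1 + c\<^sup>2) / (1 + c\<^sup>2)"
      unfolding cos_2_arctan by (simp only: times_divide_eq_right)
    also have "\<dots> = - 2" by (rule nonzero_mult_div_cancel_right) (use p in simp)
    finally have cos: "q * cos (2 * arctan c) = - 2" .
    define \<theta> where "\<theta> = 2 * arctan c"
    have "q * sin (2 * \<theta>) = 2 * sin \<theta> * (q * cos \<theta>)" unfolding sin_double by simp
    also have "q * cos \<theta> = - 2" unfolding \<theta>_def by (rule cos)
    finally have "q * sin (2 * \<theta>) = - 4 * sin \<theta>" by simp
    moreover have "y s 0 = 2 * \<theta>" for s by (simp add: y_def \<theta>_def)
    ultimately show "(- 1) * (2 * sin (y (- 1) 0 / 2)) - 1 * (2 * sin (y 1 0 / 2)) = q * sin (y (- 1) 0)"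
      by simp
    show "\<bar>(- 1) * (2 * sin (y (- 1) x / 2))\<bar> \<le> 4 * c * exp (- x) \<and> \<bar>sin (y (- 1) x / 2)\<bar> \<le> 4 * c * exp (- x)" for x
      using abs_sin_2_arctan_le(1)[of "c * exp (- x)"] c0 unfolding half by (simp add: abs_mult)
    show "\<bar>1 * (2 * sin (y 1 x / 2))\<bar> \<le> 4 * c * exp x \<and> \<bar>sin (y 1 x / 2)\<bar> \<le> 4 * c * exp x" for x
      using abs_sin_2_arctan_le(1)[of "c * exp x"] c0 unfolding half by (simp add: abs_mult)
    show "Q q x = y (- 1) x" if "x \<ge> 0" for x using that by (simp add: Q_def y_def c_def)
    show "Q q x = y 1 x" if "x \<le> 0" for x using that by (simp add: Q_def y_def c_def)
  qed ((rule y first_order_imp_second_order[OF y]; simp)+)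
qed

lemma Q_pos:
  assumes "\<bar>q\<bar> > 2"
  shows "Q q x > 0"
proof -
  have "(q + 2) / (q - 2) > 0" using assms by (cases "q > 0") (auto simp: zero_less_divide_iff)
  then show ?thesis by (simp add: Q_def)
qed

lemma Q_in_H1:
  assumes "\<bar>q\<bar> > 2"
  shows "Q q \<in> H1"
proof -
  have d: "Q q \<in> Hdot1" using Q_solves[OF assms] by (simp add: solves_def H1sin_def)
  then have "continuous_on UNIV (Q q)" by (simp add: Hdot1_def)
  then have m: "Q q \<in> borel_measurable borel" by (rule borel_measurable_continuous_onI)
  have "\<bar>Q q x\<bar> \<le> 4 * sqrt ((q + 2) / (q - 2)) * exp (- \<bar>x\<bar>)" for x
  proof -
    have "sqrt ((q + 2) / (q - 2)) * exp (- \<bar>x\<bar>) \<ge> 0"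
      using assms by (cases "q > 0") (auto simp: zero_le_divide_iff)
    from arctan_le_self[OF this] show ?thesis using Q_pos[OF assms, of x] by (simp add: Q_def)
  qed
  then have "Q q \<in> L2" by (rule L2_bound[OF exp_minus_abs_L2 m])
  then show ?thesis using d by (simp add: H1_def)
qed

text \<open>The value of the kink at 0 is pi, where the sine vanishes, so the delta term drops out
  for every q and one smooth function serves as both pieces.\<close>

lemma kink_solves: "solves q kink"
proof -
  have k: "(kink has_real_derivative 1 * (2 * sin (kink x / 2))) (at x)" for x
    using arctan_exp_has_derivative[of 1 1 x] by (simp add: kink_def[abs_def])
  have half: "kink x / 2 = 2 * arctan (exp x)" for x by (simp add: kink_def)
  show ?thesis
  proof (rule glued_pieces_solve[where yp = kink and ym = kink and C = 4
        and pp = "\<lambda>x. 1 * (2 * sin (kink x / 2))" and pm = "\<lambda>x. 1 * (2 * sin (kink x / 2))"])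
    have "sin (kink 0) = 0" by (simp add: kink_def arctan_one)
    then show "1 * (2 * sin (kink 0 / 2)) - 1 * (2 * sin (kink 0 / 2)) = q * sin (kink 0)" by simp
    show "\<bar>1 * (2 * sin (kink x / 2))\<bar> \<le> 4 * exp (- x) \<and> \<bar>sin (kink x / 2)\<bar> \<le> 4 * exp (- x)" for x
      using abs_sin_2_arctan_le(2)[of "exp x"] unfolding half by (simp add: abs_mult exp_minus divide_inverse)
    show "\<bar>1 * (2 * sin (kink x / 2))\<bar> \<le> 4 * exp x \<and> \<bar>sin (kink x / 2)\<bar> \<le> 4 * exp x" for x
      using abs_sin_2_arctan_le(1)[of "exp x"] unfolding half by (simp add: abs_mult)
  qed ((rule refl k first_order_imp_second_order[OF k]; simp)+)
qed

lemma kink_at_bot: "(kink \<longlongrightarrow> 0) at_bot"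
proof -
  have "((\<lambda>x. 4 * arctan (exp x)) \<longlongrightarrow> 4 * arctan 0) (at_bot :: real filter)"
    by (intro tendsto_intros exp_at_bot)
  then show ?thesis by (simp add: kink_def[abs_def])
qed

lemma kink_at_top: "(kink \<longlongrightarrow> 2 * pi) at_top"
proof -
  have "((\<lambda>x. 4 * arctan (exp x)) \<longlongrightarrow> 4 * (pi / 2)) (at_top :: real filter)"
    by (intro tendsto_intros filterlim_compose[OF tendsto_arctan_at_top exp_at_top])
  then show ?thesis by (simp add: kink_def[abs_def])
qed

section \<open>Classification of the solutions with given limits\<close>

text \<open>Shifting the right half by L and reflecting the left half brings both under
  \<open>pendulum_half_line\<close>. The condition on L holds for 0 and 2 pi. It concerns sin(x) and
  not sin(x/2), whose sign a shift by 2 pi flips, so L survives in the jump condition.\<close>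

lemma solution_shape:
  assumes "solves q u" and bot: "(u \<longlongrightarrow> 0) at_bot" and top: "(u \<longlongrightarrow> L) at_top"
    and L: "\<And>x. sin (x - L) = sin x"
  obtains c d where "\<And>x. x \<ge> 0 \<Longrightarrow> u x = L + 4 * arctan (c * exp (- x))"
    "\<And>x. x \<le> 0 \<Longrightarrow> u x = 4 * arctan (d * exp x)"
    "- 2 * sin ((u 0 - L) / 2) - 2 * sin (u 0 / 2) = q * sin (u 0)"
proof -
  obtain yp pp ym pm where
    yp: "\<And>x. (yp has_real_derivative pp x) (at x)" "\<And>x. (pp has_real_derivative sin (u x)) (at x)"
      "\<And>x. x \<ge> 0 \<Longrightarrow> yp x = u x"
    and ym: "\<And>x. (ym has_real_derivative pm x) (at x)" "\<And>x. (pm has_real_derivative sin (u x)) (at x)"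
      "\<And>x. x \<le> 0 \<Longrightarrow> ym x = u x"
    and jump: "pp 0 - pm 0 = q * sin (u 0)"
    using solves_imp_pieces[OF assms(1)] by blast
  obtain c where c: "\<And>x. x \<ge> 0 \<Longrightarrow> yp x - L = 4 * arctan (c * exp (- x))"
    and c0: "pp 0 = - 2 * sin ((yp 0 - L) / 2)"
  proof (rule pendulum_half_line[where y = "\<lambda>x. yp x - L" and p = pp])
    show "((\<lambda>x. yp x - L) has_real_derivative pp x) (at x)" for x
      by (auto intro!: derivative_eq_intros yp)
    show "(pp has_real_derivative sin (yp x - L)) (at x)" if "x \<ge> 0" for x
      using yp(2)[of x] yp(3)[OF that] L by simp
    have "((\<lambda>x. u x - L) \<longlongrightarrow> 0) at_top" using tendsto_diff[OF top tendsto_const[of L]] by simp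
    then show "((\<lambda>x. yp x - L) \<longlongrightarrow> 0) at_top"
      by (rule Lim_transform_eventually)
        (use yp(3) in \<open>auto intro!: eventually_mono[OF eventually_ge_at_top[of 0]]\<close>)
  qed blast
  obtain d where d: "\<And>x. x \<ge> 0 \<Longrightarrow> ym (- x) = 4 * arctan (d * exp (- x))"
    and d0: "- pm (- 0) = - 2 * sin (ym (- 0) / 2)"
  proof (rule pendulum_half_line[where y = "\<lambda>x. ym (- x)" and p = "\<lambda>x. - pm (- x)"])
    show "((\<lambda>x. ym (- x)) has_real_derivative - pm (- x)) (at x)" for x
      using ym(1)[of "- x"] by (simp add: DERIV_mirror)
    show "((\<lambda>x. - pm (- x)) has_real_derivative sin (ym (- x))) (at x)" if "x \<ge> 0" for x
    proof -
      have "((\<lambda>x. pm (- x)) has_real_derivative - sin (u (- x))) (at x)"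
        using ym(2)[of "- x"] by (simp add: DERIV_mirror)
      from DERIV_minus[OF this] show ?thesis using ym(3)[of "- x"] that by simp
    qed
    have "((\<lambda>x. u (- x)) \<longlongrightarrow> 0) at_top" using bot by (simp add: filterlim_at_bot_mirror)
    then show "((\<lambda>x. ym (- x)) \<longlongrightarrow> 0) at_top"
      by (rule Lim_transform_eventually)
        (use ym(3) in \<open>auto intro!: eventually_mono[OF eventually_ge_at_top[of 0]]\<close>)
  qed blast
  show ?thesis
  proof (rule that[of c d])
    show "u x = L + 4 * arctan (c * exp (- x))" if "x \<ge> 0" for x
      using c[OF that] yp(3)[OF that] by simp
    show "u x = 4 * arctan (d * exp x)" if "x \<le> 0" for x
      using d[of "- x"] ym(3)[OF that] that by simp
    show "- 2 * sin ((u 0 - L) / 2) - 2 * sin (u 0 / 2) = q * sin (u 0)"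
      using jump c0 d0 yp(3)[of 0] ym(3)[of 0] by simp
  qed
qed

text \<open>The common value at 0 makes the two half line constants equal. Dividing the jump
  condition by sin(2 arctan c), nonzero for c \<noteq> 0, leaves q cos(2 arctan c) = -2, an equation
  for c^2 alone.\<close>

lemma H1_solution_shape:
  assumes "solves q u" "u \<in> H1" "u \<noteq> (\<lambda>x. 0)"
  obtains c where "\<And>x. u x = 4 * arctan (c * exp (- \<bar>x\<bar>))" "c \<noteq> 0" "c\<^sup>2 * (q - 2) = q + 2"
proof -
  obtain c d where c: "\<And>x. x \<ge> 0 \<Longrightarrow> u x = 0 + 4 * arctan (c * exp (- x))"
    and d: "\<And>x. x \<le> 0 \<Longrightarrow> u x = 4 * arctan (d * exp x)"
    and j: "- 2 * sin ((u 0 - 0) / 2) - 2 * sin (u 0 / 2) = q * sin (u 0)"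
    using solution_shape[OF assms(1) H1_tendsto_0(2)[OF assms(2)] H1_tendsto_0(1)[OF assms(2)]] by auto
  have "arctan d = arctan c" using c[of 0] d[of 0] by simp
  then have "d = c" by (simp add: arctan_eq_iff)
  then have u: "u x = 4 * arctan (c * exp (- \<bar>x\<bar>))" for x
    using c[of x] d[of x] by (cases "x \<ge> 0") auto
  have c0: "c \<noteq> 0" using u assms(3) by auto
  have p: "1 + c\<^sup>2 > 0" by (simp add: add_pos_nonneg)
  define \<theta> where "\<theta> = 2 * arctan c"
  have "u 0 = 2 * \<theta>" by (simp add: u \<theta>_def)
  then have "- 4 * sin \<theta> = q * sin (2 * \<theta>)" using j by simp
  then have "sin \<theta> * (q * cos \<theta> + 2) = 0"
    unfolding sin_double by (simp add: algebra_simps)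
  then have "sin (2 * arctan c) * (q * cos (2 * arctan c) + 2) = 0"
    unfolding \<theta>_def .
  moreover have "sin (2 * arctan c) \<noteq> 0" using c0 p by (simp add: sin_2_arctan)
  ultimately have "q * cos (2 * arctan c) + 2 = 0" by simp
  then have "q * (1 - c\<^sup>2) + 2 * (1 + c\<^sup>2) = 0"
    unfolding cos_2_arctan using p by (simp add: field_simps)
  then have "c\<^sup>2 * (q - 2) = q + 2" by (simp add: algebra_simps)
  with u c0 show ?thesis by (rule that)
qed

text \<open>For |q| \<le> 2 the left side of c^2 (q - 2) = q + 2 is at most 0 and the right side at
  least 0. So both vanish, which forces q = -2 and then c = 0, a contradiction.\<close>

lemma no_nontrivial_H1_solution:
  assumes "\<bar>q\<bar> \<le> 2" "solves q u" "u \<in> H1"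
  shows "u = (\<lambda>x. 0)"
proof (rule ccontr)
  assume "u \<noteq> (\<lambda>x. 0)"
  then obtain c where c: "c \<noteq> 0" "c\<^sup>2 * (q - 2) = q + 2"
    using H1_solution_shape[OF assms(2,3)] by metis
  then have c2: "c\<^sup>2 > 0" by simp
  then have "c\<^sup>2 * (q - 2) \<le> 0" using assms(1) by (intro mult_nonneg_nonpos) auto
  then have "q = - 2" using c(2) assms(1) by linarith
  then show False using c by simp
qed

text \<open>The equation for c^2 has two roots; positivity at 0 selects the positive one, the other
  giving -Q.\<close>

lemma positive_H1_solution_eq_Q:
  assumes "\<bar>q\<bar> > 2" "solves q u" "u \<in> H1" "\<And>x. u x > 0"
  shows "u = Q q"
proof -
  have "u \<noteq> (\<lambda>x. 0)" using assms(4) by (metis less_irrefl)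
  then obtain c where u: "\<And>x. u x = 4 * arctan (c * exp (- \<bar>x\<bar>))" and c: "c\<^sup>2 * (q - 2) = q + 2"
    using H1_solution_shape[OF assms(2,3)] by metis
  have "c > 0" using assms(4)[of 0] u[of 0] by simp
  moreover have "c\<^sup>2 = (q + 2) / (q - 2)" using c assms(1) by (simp add: field_simps)
  ultimately have "c = sqrt ((q + 2) / (q - 2))" by (simp add: real_sqrt_unique)
  then show ?thesis using u by (auto simp: Q_def)
qed

text \<open>Since a shift by 2 pi flips the half-angle sine, the left side of the jump condition
  cancels and q sin(u(0)) = 0. The two half line formulas confine u(0) to (0, 2 pi), hence u(0) =
  pi, which determines \<open>c\<close> and \<open>d\<close>.\<close>

lemma kink_unique:
  assumes q: "q \<noteq> 0" and "solves q u" "(u \<longlongrightarrow> 0) at_bot" "(u \<longlongrightarrow> 2 * pi) at_top"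
  shows "u = kink"
proof -
  obtain c d where c: "\<And>x. x \<ge> 0 \<Longrightarrow> u x = 2 * pi + 4 * arctan (c * exp (- x))"
    and d: "\<And>x. x \<le> 0 \<Longrightarrow> u x = 4 * arctan (d * exp x)"
    and j: "- 2 * sin ((u 0 - 2 * pi) / 2) - 2 * sin (u 0 / 2) = q * sin (u 0)"
    using solution_shape[OF assms(2-4)] by (auto simp: sin_diff)
  have "sin ((u 0 - 2 * pi) / 2) = - sin (u 0 / 2)" by (simp add: diff_divide_distrib sin_diff)
  \<comment> \<open>Centering at pi turns the range (0, 2 pi) into (-pi, pi), where 0 is the only
    zero of the sine.\<close>
  then have "sin (u 0 - pi) = 0" using j q by (simp add: sin_diff)
  moreover have u0: "u 0 = 2 * pi + 4 * arctan c" "u 0 = 4 * arctan d"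
    using c[of 0] d[of 0] by simp_all
  then have "- pi < u 0 - pi" "u 0 - pi < pi"
    using arctan_lbound[of c] arctan_ubound[of d] by linarith+
  ultimately have "u 0 = pi" using sin_eq_0_pi[of "u 0 - pi"] by simp
  then have "arctan d = arctan 1" "arctan c = arctan (- 1)"
    using u0 by (simp_all add: arctan_one arctan_minus)
  then have cd: "d = 1" "c = - 1" by (simp_all only: arctan_eq_iff)
  show ?thesis
  proof
    fix x
    show "u x = kink x"
    proof (cases "x \<ge> 0")
      case True
      \<comment> \<open>The identity arctan(1/t) = pi/2 - arctan t for t > 0 converts the right
        half, written with e^(-x), into the kink formula in e^x.\<close>
      have "arctan (inverse (exp x)) = pi / 2 - arctan (exp x)"
        using arctan_inverse[of "exp x"] by (simp add: inverse_eq_divide)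
      moreover have "c * exp (- x) = - inverse (exp x)" by (simp add: cd exp_minus)
      ultimately have "u x = 2 * pi + 4 * - (pi / 2 - arctan (exp x))"
        using c[OF True] by (simp only: arctan_minus)
      then show ?thesis by (simp add: kink_def)
    next
      case False
      then show ?thesis using d[of x] cd by (simp add: kink_def)
    qed
  qed
qed

theorem proposition1p2:
  fixes q :: real
  assumes "q \<noteq> 0"
  shows
    "(\<bar>q\<bar> \<le> 2 \<longrightarrow> \<not> (\<exists>u\<in>H1. solves q u \<and> u \<noteq> (\<lambda>x. 0))) \<and>
     (\<bar>q\<bar> > 2 \<longrightarrow>
        (\<exists>!u. u \<in> H1 \<and> solves q u \<and> (\<forall>x. u x > 0)) \<and>
        Q q \<in> H1 \<and> solves q (Q q) \<and> (\<forall>x. Q q x > 0)) \<and>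
     ((\<exists>!u. u \<in> H1sin \<and> solves q u \<and> (u \<longlongrightarrow> 0) at_bot \<and> (u \<longlongrightarrow> 2 * pi) at_top) \<and>
        kink \<in> H1sin \<and> solves q kink \<and> (kink \<longlongrightarrow> 0) at_bot \<and> (kink \<longlongrightarrow> 2 * pi) at_top)"
proof (intro conjI impI)
  show "\<not> (\<exists>u\<in>H1. solves q u \<and> u \<noteq> (\<lambda>x. 0))" if "\<bar>q\<bar> \<le> 2"
    using no_nontrivial_H1_solution[OF that] by blast
  show "\<exists>!u. u \<in> H1 \<and> solves q u \<and> (\<forall>x. u x > 0)" if "\<bar>q\<bar> > 2"
    by (rule ex1I[of _ "Q q"])
      (use Q_in_H1[OF that] Q_solves[OF that] Q_pos[OF that] positive_H1_solution_eq_Q[OF that] in blast)+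
  show "kink \<in> H1sin" using kink_solves[of q] by (simp add: solves_def)
  then show "\<exists>!u. u \<in> H1sin \<and> solves q u \<and> (u \<longlongrightarrow> 0) at_bot \<and> (u \<longlongrightarrow> 2 * pi) at_top"
    using kink_solves kink_at_bot kink_at_top kink_unique[OF assms] by blast
qed (use Q_in_H1 Q_solves Q_pos kink_solves kink_at_bot kink_at_top in auto)

end
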